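(* $(\mathfrak D,\sqcup\!\sqcup,u,\Delta,\epsilon)$ is a connected graded Hopf algebra of finite type over $\mathbb F_q$.
   Context: Let $q$ be a power of a prime and $\mathbb F_q$ the field with $q$ elements. Let $\Gamma=\{x_{n,\varepsilon}\}_{n\in\mathbb N,\varepsilon\in\mathbb F_q^*}$ be an alphabet with weights $w(x_{n,\varepsilon})=n$; $\langle\Gamma\rangle$ is the set of words (finite strings of letters, empty word $1$), juxtaposition is concatenation, the depth of a word is its number of letters and its weight the sum of the weights of its letters. Let $\mathfrak D$ be the $\mathbb F_q$-vector space with basis $\langle\Gamma\rangle$, graded by weight; write $x_n:=x_{n,1}$. For positive integers $r,s,j$ put $\Delta^j_{r,s}=(-1)^{r-1}\binom{j-1}{r-1}+(-1)^{s-1}\binom{j-1}{s-1}$ if $(q-1)\mid j$ and $0$ otherwise. The bilinear products $\diamond,\sqcup\!\sqcup$ on $\mathfrak D$ are defined recursively by $1\diamond\mathfrak a=\mathfrak a\diamond1=\mathfrak a$, $1\sqcup\!\sqcup\mathfrak a=\mathfrak a\sqcup\!\sqcup1=\mathfrak a$ and, for nonempty words $\mathfrak a=x_{a,\alpha}\mathfrak a_-$, $\mathfrak b=x_{b,\beta}\mathfrak b_-$: $\mathfrak a\diamond\mathfrak b=x_{a+b,\alpha\beta}(\mathfrak a_-\sqcup\!\sqcup\mathfrak b_-)+\sum_{i+j=a+b}\Delta^j_{a,b}x_{i,\alpha\beta}(x_j\sqcup\!\sqcup(\mathfrak a_-\sqcup\!\sqcup\mathfrak b_-))$ and $\mathfrak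 a\sqcup\!\sqcup\mathfrak b=x_{a,\alpha}(\mathfrak a_-\sqcup\!\sqcup\mathfrak b)+x_{b,\beta}(\mathfrak a\sqcup\!\sqcup\mathfrak b_-)+\mathfrak a\diamond\mathfrak b$ ($i,j$ positive integers). For a word $\mathfrak a=x_{i_1}\cdots x_{i_m}$ with all characters $1$ put $[\mathfrak a]=(-1)^m\Delta^{i_1}_{1,w(\mathfrak a)+1}\cdots\Delta^{i_m}_{1,w(\mathfrak a)+1}x_{i_1}\sqcup\!\sqcup\cdots\sqcup\!\sqcup x_{i_m}$, $[1]=1$. The coproduct $\Delta:\mathfrak D\to\mathfrak D\otimes\mathfrak D$ is linear with $\Delta(1)=1\otimes1$, $\Delta(x_{n,\varepsilon})=1\otimes x_{n,\varepsilon}+\sum_{r\ge1,\ r+w(\mathfrak a)=n}\binom{r+\mathrm{depth}(\mathfrak a)-2}{\mathrm{depth}(\mathfrak a)}x_{r,\varepsilon}\otimes[\mathfrak a]$ (sum over words $\mathfrak a$ with all characters $1$, $\binom{a}{b}=a(a-1)\cdots(a-b+1)/b!$), and for $\mathfrak u=x_{u,\varepsilon}\mathfrak v$ of depth $\ge2$, writing $\Delta(x_{u,\varepsilon})=1\otimes x_{u,\varepsilon}+\sum a\otimes b$ ($a$ letters) and $\Delta(\mathfrak v)=\sum a_{\mathfrak v}\otimes b_{\mathfrak v}$, $\Delta(\mathfrak u)=1\otimes\mathfrak u+\sum(a\,a_{\mathfrak v})\otimes(b\sqcup\!\sqcup b_{\mathfrak v})$. The unit $u:\mathbb F_q\to\mathfrak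 D$ sends $1$ to the empty word, and the counit $\epsilon:\mathfrak D\to\mathbb F_q$ is $\epsilon(1)=1$, $\epsilon(\mathfrak w)=0$ for nonempty words $\mathfrak w$. *)

theory Defs
  imports Main
begin

text \<open>An element of the free vector space on a basis set B is a finitely supported
function from B to the scalars; the tensor product of two such spaces is the
free vector space on the product basis B x B.\<close>

definition supp :: "('b \<Rightarrow> 'a::zero) \<Rightarrow> 'b set" where
  "supp F = {x. F x \<noteq> 0}"

definition delta :: "'b \<Rightarrow> 'b \<Rightarrow> 'a::{zero,one}" where
  "delta b = (\<lambda>x. if x = b then 1 else 0)"

definition fvec :: "'b set \<Rightarrow> ('b \<Rightarrow> 'a::zero) set" where
  "fvec B = {F. finite (supp F) \<and> supp F \<subseteq> B}"

definition hopf_algebra_on ::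
  "'w set \<Rightarrow> (('w \<Rightarrow> 'a::field) \<Rightarrow> ('w \<Rightarrow> 'a) \<Rightarrow> ('w \<Rightarrow> 'a)) \<Rightarrow> ('w \<Rightarrow> 'a)
    \<Rightarrow> (('w \<Rightarrow> 'a) \<Rightarrow> ('w \<times> 'w \<Rightarrow> 'a)) \<Rightarrow> (('w \<Rightarrow> 'a) \<Rightarrow> 'a) \<Rightarrow> bool" where
  "hopf_algebra_on B m u Cop eps \<longleftrightarrow>
    \<comment> \<open>algebra: unit, closure, bilinearity, associativity, unit laws\<close>
    u \<in> fvec B \<and>
    (\<forall>F\<in>fvec B. \<forall>G\<in>fvec B. m F G \<in> fvec B) \<and>
    (\<forall>F\<in>fvec B. \<forall>G\<in>fvec B. \<forall>H\<in>fvec B. \<forall>c.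
        m (\<lambda>w. c * F w + G w) H = (\<lambda>w. c * m F H w + m G H w) \<and>
        m H (\<lambda>w. c * F w + G w) = (\<lambda>w. c * m H F w + m H G w)) \<and>
    (\<forall>F\<in>fvec B. \<forall>G\<in>fvec B. \<forall>H\<in>fvec B. m (m F G) H = m F (m G H)) \<and>
    (\<forall>F\<in>fvec B. m u F = F \<and> m F u = F) \<and>
    \<comment> \<open>coalgebra: closure, linearity, coassociativity, counit laws\<close>
    (\<forall>F\<in>fvec B. Cop F \<in> fvec (B \<times> B)) \<and>
    (\<forall>F\<in>fvec B. \<forall>G\<in>fvec B. \<forall>c. Cop (\<lambda>w. c * F w + G w) = (\<lambda>p. c * Cop F p + Cop G p)) \<and>
    (\<forall>F\<in>fvec B. \<forall>G\<in>fvec B. \<forall>c. eps (\<lambda>w. c * F w + G w) = c * eps F + eps G) \<and>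
    (\<forall>F\<in>fvec B.
        (\<lambda>(x, y, z). \<Sum>p\<in>supp (Cop F). Cop F p * Cop (delta (fst p)) (x, y) * delta (snd p) z)
      = (\<lambda>(x, y, z). \<Sum>p\<in>supp (Cop F). Cop F p * delta (fst p) x * Cop (delta (snd p)) (y, z))) \<and>
    (\<forall>F\<in>fvec B.
        (\<lambda>w. \<Sum>p\<in>supp (Cop F). Cop F p * eps (delta (fst p)) * delta (snd p) w) = F \<and>
        (\<lambda>w. \<Sum>p\<in>supp (Cop F). Cop F p * delta (fst p) w * eps (delta (snd p))) = F) \<and>
    \<comment> \<open>bialgebra compatibility\<close>
    (\<forall>F\<in>fvec B. \<forall>G\<in>fvec B.
        Cop (m F G) = (\<lambda>(x, y). \<Sum>p\<in>supp (Cop F). \<Sum>p'\<in>supp (Cop G).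
            Cop F p * Cop G p' * m (delta (fst p)) (delta (fst p')) x * m (delta (snd p)) (delta (snd p')) y)) \<and>
    Cop u = (\<lambda>(x, y). u x * u y) \<and>
    (\<forall>F\<in>fvec B. \<forall>G\<in>fvec B. eps (m F G) = eps F * eps G) \<and>
    eps u = 1 \<and>
    \<comment> \<open>existence of an antipode\<close>
    (\<exists>S. (\<forall>F\<in>fvec B. S F \<in> fvec B) \<and>
         (\<forall>F\<in>fvec B. \<forall>G\<in>fvec B. \<forall>c. S (\<lambda>w. c * F w + G w) = (\<lambda>w. c * S F w + S G w)) \<and>
         (\<forall>F\<in>fvec B.
            (\<lambda>w. \<Sum>p\<in>supp (Cop F). Cop F p * m (S (delta (fst p))) (delta (snd p)) w) = (\<lambda>w. eps F * u w) \<and>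
            (\<lambda>w. \<Sum>p\<in>supp (Cop F). Cop F p * m (delta (fst p)) (S (delta (snd p))) w) = (\<lambda>w. eps F * u w)))"

definition homog :: "('w \<Rightarrow> nat) \<Rightarrow> nat \<Rightarrow> ('w \<Rightarrow> 'a::zero) \<Rightarrow> bool" where
  "homog wt n F \<longleftrightarrow> (\<forall>w\<in>supp F. wt w = n)"

text \<open>Connected graded Hopf algebra of finite type, the grading being given by a
weight on the basis (so the space is the direct sum of the spans D_n of the basis
elements of weight n).\<close>

definition connected_graded_hopf_finite_type ::
  "'w set \<Rightarrow> (('w \<Rightarrow> 'a::field) \<Rightarrow> ('w \<Rightarrow> 'a) \<Rightarrow> ('w \<Rightarrow> 'a)) \<Rightarrow> ('w \<Rightarrow> 'a)
    \<Rightarrow> (('w \<Rightarrow> 'a) \<Rightarrow> ('w \<times> 'w \<Rightarrow> 'a)) \<Rightarrow> (('w \<Rightarrow> 'a) \<Rightarrow> 'a) \<Rightarrow> ('w \<Rightarrow> nat) \<Rightarrow> bool" where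
  "connected_graded_hopf_finite_type B m u Cop eps wt \<longleftrightarrow>
    hopf_algebra_on B m u Cop eps \<and>
    \<comment> \<open>graded\<close>
    homog wt 0 u \<and>
    (\<forall>F\<in>fvec B. \<forall>G\<in>fvec B. \<forall>i j. homog wt i F \<and> homog wt j G \<longrightarrow> homog wt (i + j) (m F G)) \<and>
    (\<forall>F\<in>fvec B. \<forall>n. homog wt n F \<longrightarrow> (\<forall>p\<in>supp (Cop F). wt (fst p) + wt (snd p) = n)) \<and>
    (\<forall>F\<in>fvec B. \<forall>n. n > 0 \<and> homog wt n F \<longrightarrow> eps F = 0) \<and>
    \<comment> \<open>connected: degree 0 part is the scalars\<close>
    (\<forall>F\<in>fvec B. homog wt 0 F \<longrightarrow> (\<exists>c. F = (\<lambda>w. c * u w))) \<and>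
    \<comment> \<open>finite type: each homogeneous component is finite dimensional\<close>
    (\<forall>n. finite {w\<in>B. wt w = n})"

type_synonym 'a letter = "nat \<times> 'a"   \<comment> \<open>(n, eps) stands for x_{n,eps}\<close>
type_synonym 'a word = "'a letter list"

definition valid_words :: "'a::zero word set" where
  "valid_words = {w. \<forall>l\<in>set w. fst l \<ge> 1 \<and> snd l \<noteq> 0}"

definition wt :: "'a word \<Rightarrow> nat" where
  "wt w = sum_list (map fst w)"

definition Dc :: "nat \<Rightarrow> nat \<Rightarrow> nat \<Rightarrow> 'a::{field,finite}" where
  "Dc j r s = (if (card (UNIV :: 'a set) - 1) dvd j
      then of_int ((-1) ^ (r - 1) * int ((j - 1) choose (r - 1)) + (-1) ^ (s - 1) * int ((j - 1) choose (s - 1)))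
      else 0)"

definition prepend :: "'b \<Rightarrow> ('b list \<Rightarrow> 'a::zero) \<Rightarrow> ('b list \<Rightarrow> 'a)" where
  "prepend x F = (\<lambda>w. case w of [] \<Rightarrow> 0 | y # w' \<Rightarrow> if y = x then F w' else 0)"

definition lin :: "('b \<Rightarrow> 'a::field) \<Rightarrow> ('b \<Rightarrow> 'c \<Rightarrow> 'a) \<Rightarrow> ('c \<Rightarrow> 'a)" where
  "lin F phi = (\<lambda>c. \<Sum>b\<in>supp F. F b * phi b c)"

text \<open>Shuffle product of two words, computed with a fuel parameter (the diamond
product is inlined in the case of two nonempty words).\<close>
primrec shN :: "nat \<Rightarrow> 'a::{field,finite} word \<Rightarrow> 'a word \<Rightarrow> 'a word \<Rightarrow> 'a" where
  "shN 0 u v = (\<lambda>w. 0)"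
| "shN (Suc N) u v =
     (case u of [] \<Rightarrow> delta v
      | x # u' \<Rightarrow> (case v of [] \<Rightarrow> delta u
        | y # v' \<Rightarrow> (\<lambda>w. prepend x (shN N u' v) w + prepend y (shN N u v') w
            + prepend (fst x + fst y, snd x * snd y) (shN N u' v') w
            + (\<Sum>j\<in>{1..<fst x + fst y}. Dc j (fst x) (fst y) *
                 prepend (fst x + fst y - j, snd x * snd y) (lin (shN N u' v') (\<lambda>w'. shN N [(j, 1)] w')) w))))"

definition sh :: "'a::{field,finite} word \<Rightarrow> 'a word \<Rightarrow> 'a word \<Rightarrow> 'a" where
  "sh u v = shN (Suc (length u + length v)) u v"

definition shuffle_mult :: "('a::{field,finite} word \<Rightarrow> 'a) \<Rightarrow> ('a word \<Rightarrow> 'a) \<Rightarrow> ('a word \<Rightarrow> 'a)" where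
  "shuffle_mult F G = (\<lambda>w. \<Sum>u\<in>supp F. \<Sum>v\<in>supp G. F u * G v * sh u v w)"

definition ones :: "nat \<Rightarrow> 'a::{field,finite} word set" where
  "ones n = {a. (\<forall>l\<in>set a. fst l \<ge> 1 \<and> snd l = 1) \<and> wt a = n}"

definition bracket :: "'a::{field,finite} word \<Rightarrow> 'a word \<Rightarrow> 'a" where
  "bracket a = (\<lambda>w. (-1) ^ length a * prod_list (map (\<lambda>l. Dc (fst l) 1 (wt a + 1)) a)
      * foldr (\<lambda>l F. shuffle_mult (delta [l]) F) a (delta []) w)"

text \<open>Delta(x_{n,eps}) - 1 (x) x_{n,eps}, as a tensor.\<close>
definition copL :: "'a::{field,finite} letter \<Rightarrow> ('a word \<times> 'a word \<Rightarrow> 'a)" where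
  "copL x = (\<lambda>p. \<Sum>r\<in>{1..fst x}. \<Sum>a\<in>ones (fst x - r).
      of_nat ((r + length a - 2) choose length a) * delta [(r, snd x)] (fst p) * bracket a (snd p))"

primrec cop :: "'a::{field,finite} word \<Rightarrow> ('a word \<times> 'a word \<Rightarrow> 'a)" where
  "cop [] = delta ([], [])"
| "cop (x # v) = (\<lambda>p. delta ([], x # v) p +
      (\<Sum>q\<in>supp (copL x). \<Sum>q'\<in>supp (cop v).
          copL x q * cop v q' * delta (fst q @ fst q') (fst p) * sh (snd q) (snd q') (snd p)))"

definition Cop :: "('a::{field,finite} word \<Rightarrow> 'a) \<Rightarrow> ('a word \<times> 'a word \<Rightarrow> 'a)" where
  "Cop F = (\<lambda>p. \<Sum>w\<in>supp F. F w * cop w p)"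

definition counit :: "('a::{field,finite} word \<Rightarrow> 'a) \<Rightarrow> 'a" where
  "counit F = F []"

end

theory Submission
  imports Defs "HOL-Library.Cardinality" "HOL-Computational_Algebra.Computational_Algebra"
begin

text \<open>The algebra is realised faithfully by functions. Take a chain of \<open>\<F>\<^sub>q\<close>-vector spaces with generic
  increments and let the letter \<open>x\<^sub>n\<close> evaluate, on each level, to the sum of \<open>1 / a\<^sup>n\<close> over the vectors
  \<open>a\<close> that are monic on that level; a word evaluates to the nested sum over decreasing levels. Partial
  fractions for \<open>1 / (a\<^sup>r b\<^sup>s)\<close> turn the shuffle product into the product of functions. If the chain is cut
  in two, the upper part is transported by the additive polynomial \<open>e\<close> of the lower part, where
  \<open>X / e(X) = 1 + \<Sum> x\<^sub>j X\<^sup>j\<close> over \<open>j\<close> divisible by \<open>q - 1\<close>; expanding the power sums in powers of \<open>e\<close> gives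
  exactly the coproduct, so the coproduct is dual to concatenation of chains. Since the evaluations are
  linearly independent over an infinite field, every axiom reduces to an identity between functions.
  The antipode exists because the bialgebra is connected and graded.\<close>

section \<open>Shuffles of words\<close>

text \<open>Inductions on the recursions themselves would have to carry the binomials of
  \<open>Dc\<close> through nested products; identities of functions hide them. The vectors of the
  chain never appear. On a level they form a coset v + W. The normalised additive polynomial e of W
  has derivative 1, so the sum of 1 / (a - X) over a in v + W is 1 / (e(v) - e(X)) = y / (1 - y
  e(X)) with y = 1 / e(v), and adjoining v to W replaces e by e - y^(q-1) e^q. Only y enters, so
  these formulas serve as definitions and y may be any scalar, even 0, where a level contributes
  nothing. This freedom makes linear independence a question about polynomials in y. Similarly X /
  e(X) is X times the logarithmic derivative of e; the sum of c^(-j) over nonzero c in F_q is -1 if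
  q - 1 divides j and 0 otherwise, which is the source of the condition in \<open>Dc\<close>. The
  field is infinite so that coefficients can be compared by evaluation: at a scaling factor s in the
  product formula, at y in the independence proof. The exponents attached to levels separate the
  characters of letters.\<close>

lemma wt_simps [simp]: "wt [] = 0" "wt (x # w) = fst x + wt w" "wt (u @ v) = wt u + wt v"
  by (simp_all add: wt_def)

lemma valid_words_simps [simp]:
  "[] \<in> valid_words"
  "x # w \<in> valid_words \<longleftrightarrow> fst x \<ge> 1 \<and> snd x \<noteq> 0 \<and> w \<in> valid_words"
  "u @ v \<in> valid_words \<longleftrightarrow> u \<in> valid_words \<and> v \<in> valid_words"
  by (auto simp: valid_words_def)

lemma length_le_wt: "w \<in> valid_words \<Longrightarrow> length w \<le> wt w"
  by (induction w) auto

lemma wt_eq_0_iff: "w \<in> valid_words \<Longrightarrow> wt w = 0 \<longleftrightarrow> w = []"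
  by (cases w) auto

lemma letter_le_wt: "l \<in> set w \<Longrightarrow> fst l \<le> wt w"
  by (induction w) auto

lemma finite_valid_words_wt_le: "finite {w \<in> valid_words :: 'a::{zero,finite} word set. wt w \<le> n}"
proof (rule finite_subset)
  show "{w \<in> valid_words :: 'a word set. wt w \<le> n}
    \<subseteq> {w. set w \<subseteq> {..n} \<times> UNIV \<and> length w \<le> n}"
    using length_le_wt letter_le_wt by (fastforce dest: order_trans)
  show "finite {w. set w \<subseteq> {..n} \<times> (UNIV :: 'a set) \<and> length w \<le> n}"
    by (rule finite_lists_length_le) auto
qed

lemma finite_valid_words_wt: "finite {w \<in> valid_words :: 'a::{zero,finite} word set. wt w = n}"
  by (rule finite_subset[OF _ finite_valid_words_wt_le[of n]]) auto

lemma ones_subset: "ones n \<subseteq> {w \<in> valid_words. wt w = n}"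
  by (auto simp: ones_def valid_words_def)

lemma finite_ones: "finite (ones n)"
  by (rule finite_subset[OF ones_subset finite_valid_words_wt])

lemma prepend_simps [simp]:
  "prepend x F [] = 0" "prepend x F (y # w) = (if y = x then F w else 0)"
  by (simp_all add: prepend_def)

lemma prepend_nonzeroE:
  assumes "prepend x F w \<noteq> 0"
  obtains w' where "w = x # w'" "F w' \<noteq> 0"
  using assms by (cases w) (auto split: if_splits)

lemma delta_nonzero [simp]: "delta b x \<noteq> (0 :: 'a::zero_neq_one) \<longleftrightarrow> x = b"
  by (simp add: delta_def)

lemma supp_delta [simp]: "supp (delta b :: 'b \<Rightarrow> 'a::zero_neq_one) = {b}"
  by (auto simp: supp_def)

lemma lin_nonzeroE:
  assumes "lin F phi c \<noteq> 0"
  obtains b where "F b \<noteq> 0" "phi b c \<noteq> 0"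
proof -
  from assms obtain b where "b \<in> supp F" "F b * phi b c \<noteq> 0"
    unfolding lin_def by (rule sum.not_neutral_contains_not_neutral)
  then show ?thesis using that by auto
qed

lemma lin_cong: "(\<And>b. F b \<noteq> 0 \<Longrightarrow> phi b = psi b) \<Longrightarrow> lin F phi = lin F psi"
  by (auto simp: lin_def supp_def intro!: ext sum.cong)

lemma lin_delta [simp]: "lin (delta b) phi = phi b"
  unfolding lin_def supp_delta by (simp add: delta_def)

lemma shN_Nil [simp]: "shN (Suc N) [] v = delta v" "shN (Suc N) u [] = delta u"
  by (simp_all split: list.split)

lemma shN_Cons: "shN (Suc N) (x # u) (y # v) =
  (\<lambda>w. prepend x (shN N u (y # v)) w + prepend y (shN N (x # u) v) w
     + prepend (fst x + fst y, snd x * snd y) (shN N u v) w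
     + (\<Sum>j\<in>{1..<fst x + fst y}. Dc j (fst x) (fst y) *
          prepend (fst x + fst y - j, snd x * snd y) (lin (shN N u v) (shN N [(j, 1)])) w))"
  by simp

declare shN.simps(2) [simp del]

lemma shN_nonzero_cases:
  assumes "shN (Suc N) (x # u) (y # v) w \<noteq> 0"
  obtains w' where "w = x # w'" "shN N u (y # v) w' \<noteq> 0"
  | w' where "w = y # w'" "shN N (x # u) v w' \<noteq> 0"
  | w' where "w = (fst x + fst y, snd x * snd y) # w'" "shN N u v w' \<noteq> 0"
  | j w' w'' where "1 \<le> j" "j < fst x + fst y" "w = (fst x + fst y - j, snd x * snd y) # w'"
      "shN N u v w'' \<noteq> 0" "shN N [(j, 1)] w'' w' \<noteq> 0"
proof -
  note cases = that
  let ?j = "\<lambda>j. Dc j (fst x) (fst y) *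
          prepend (fst x + fst y - j, snd x * snd y) (lin (shN N u v) (shN N [(j, 1)])) w"
  have "prepend x (shN N u (y # v)) w \<noteq> 0 \<or> prepend y (shN N (x # u) v) w \<noteq> 0
     \<or> prepend (fst x + fst y, snd x * snd y) (shN N u v) w \<noteq> 0
     \<or> (\<exists>j\<in>{1..<fst x + fst y}. ?j j \<noteq> 0)"
  proof (rule ccontr)
    assume "\<not> ?thesis"
    then have "shN (Suc N) (x # u) (y # v) w = 0" unfolding shN_Cons by (simp del: mult_eq_0_iff)
    with assms show False ..
  qed
  moreover have thesis if "j \<in> {1..<fst x + fst y}" "?j j \<noteq> 0" for j
  proof -
    have "prepend (fst x + fst y - j, snd x * snd y) (lin (shN N u v) (shN N [(j, 1)])) w \<noteq> 0"
      using that(2) by auto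
    then obtain w' where w': "w = (fst x + fst y - j, snd x * snd y) # w'"
      "lin (shN N u v) (shN N [(j, 1)]) w' \<noteq> 0"
      by (rule prepend_nonzeroE)
    from lin_nonzeroE[OF w'(2)] obtain w'' where
      "shN N u v w'' \<noteq> 0" "shN N [(j, 1)] w'' w' \<noteq> 0" .
    with that(1) w'(1) show ?thesis by (intro cases(4)[of j w' w'']) auto
  qed
  ultimately show thesis
    by (metis prepend_nonzeroE cases(1,2,3))
qed

lemma shN_length: "shN N u v w \<noteq> 0 \<Longrightarrow> length w \<le> length u + length v"
proof (induction N arbitrary: u v w)
  case (Suc N)
  consider "u = []" | "v = []" | x u' y v' where "u = x # u'" "v = y # v'"
    by (meson neq_Nil_conv)
  then show ?case
  proof cases
    case 3
    from Suc.prems[unfolded 3] show ?thesis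
    proof (cases rule: shN_nonzero_cases)
      case (4 j w' w'')
      then show ?thesis using Suc.IH[OF 4(4)] Suc.IH[OF 4(5)] 3 by simp
    qed (use 3 in \<open>auto dest!: Suc.IH\<close>)
  qed (use Suc.prems in auto)
qed simp

text \<open>The critical recursive call is \<open>shN N [(j, 1)]\<close> on a word b occurring in
  the product of the two tails. By \<open>shN_length\<close> its arguments together have at most 1 +
  length u' + length v' letters, still fewer than u and v together, so the fuel cannot run
  out.\<close>

lemma shN_fuel:
  "length u + length v < N \<Longrightarrow> length u + length v < M \<Longrightarrow> shN N u v = shN M u v"
proof (induction N arbitrary: M u v)
  case (Suc N)
  then obtain M' where M: "M = Suc M'" by (cases M) auto
  consider "u = []" | "v = []" | x u' y v' where "u = x # u'" "v = y # v'"
    by (meson neq_Nil_conv)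
  then show ?case
  proof cases
    case 3
    have eqs: "shN N u' (y # v') = shN M' u' (y # v')" "shN N (x # u') v' = shN M' (x # u') v'"
        "shN N u' v' = shN M' u' v'"
      using Suc.prems by (auto intro!: Suc.IH simp: 3 M)
    have "lin (shN M' u' v') (shN N [(j, 1)]) = lin (shN M' u' v') (shN M' [(j, 1)])" for j
    proof (rule lin_cong)
      fix b assume "shN M' u' v' b \<noteq> 0"
      then have "length b \<le> length u' + length v'" by (rule shN_length)
      then show "shN N [(j, 1)] b = shN M' [(j, 1)] b"
        using Suc.prems by (intro Suc.IH) (auto simp: 3 M)
    qed
    then show ?thesis unfolding M 3 shN_Cons eqs by simp
  qed (simp_all add: M)
qed simp

lemma sh_Nil [simp]: "sh [] v = delta v" "sh u [] = delta u"
  by (simp_all add: sh_def)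

lemma sh_Cons: "sh (x # u) (y # v) =
  (\<lambda>w. prepend x (sh u (y # v)) w + prepend y (sh (x # u) v) w
     + prepend (fst x + fst y, snd x * snd y) (sh u v) w
     + (\<Sum>j\<in>{1..<fst x + fst y}. Dc j (fst x) (fst y) *
          prepend (fst x + fst y - j, snd x * snd y) (lin (sh u v) (sh [(j, 1)])) w))"
proof -
  let ?N = "Suc (length u + Suc (length v))"
  have eqs: "shN ?N u (y # v) = sh u (y # v)" "shN ?N (x # u) v = sh (x # u) v" "shN ?N u v = sh u v"
    unfolding sh_def by (rule shN_fuel; simp)+
  have "lin (sh u v) (shN ?N [(j, 1)]) = lin (sh u v) (sh [(j, 1)])" for j
  proof (rule lin_cong)
    fix b assume "sh u v b \<noteq> 0"
    then have "length b \<le> length u + length v" unfolding sh_def by (rule shN_length)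
    then show "shN ?N [(j, 1)] b = sh [(j, 1)] b"
      unfolding sh_def by (intro shN_fuel) auto
  qed
  then show ?thesis
    by (subst sh_def) (simp only: list.size add_Suc add_Suc_right add_0_right plus_1_eq_Suc shN_Cons eqs[unfolded add_Suc_right])
qed

lemma shN_support:
  "shN N u v w \<noteq> 0 \<Longrightarrow> u \<in> valid_words \<Longrightarrow> v \<in> valid_words \<Longrightarrow>
    w \<in> valid_words \<and> wt w = wt u + wt v"
proof (induction N arbitrary: u v w)
  case (Suc N)
  consider "u = []" | "v = []" | x u' y v' where "u = x # u'" "v = y # v'"
    by (meson neq_Nil_conv)
  then show ?case
  proof cases
    case 3
    from Suc.prems(1)[unfolded 3] show ?thesis
    proof (cases rule: shN_nonzero_cases)
      case (1 w')
      then show ?thesis using Suc.IH[OF 1(2)] Suc.prems 3 by simp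
    next
      case (2 w')
      then show ?thesis using Suc.IH[OF 2(2)] Suc.prems 3 by simp
    next
      case (3 w')
      then show ?thesis using Suc.IH[OF 3(2)] Suc.prems \<open>u = x # u'\<close> \<open>v = y # v'\<close> by simp
    next
      case (4 j w' w'')
      have "w'' \<in> valid_words \<and> wt w'' = wt u' + wt v'"
        using Suc.IH[OF 4(4)] Suc.prems 3 by simp
      with Suc.IH[OF 4(5)] 4(1) have w': "w' \<in> valid_words" "wt w' = j + (wt u' + wt v')"
        by simp_all
      have xy: "snd x \<noteq> 0" "snd y \<noteq> 0" using Suc.prems(2,3) 3 by simp_all
      show ?thesis unfolding 4(3) 3 using w' xy 4(1,2) by auto
    qed
  qed (use Suc.prems in auto)
qed simp

lemma sh_support:
  "sh u v w \<noteq> 0 \<Longrightarrow> u \<in> valid_words \<Longrightarrow> v \<in> valid_words \<Longrightarrow>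
    w \<in> valid_words \<and> wt w = wt u + wt v"
  unfolding sh_def by (rule shN_support)

section \<open>Finitely supported vectors and the operations preserving them\<close>

lemma fvecI: "finite A \<Longrightarrow> A \<subseteq> B \<Longrightarrow> (\<And>x. F x \<noteq> 0 \<Longrightarrow> x \<in> A) \<Longrightarrow> F \<in> fvec B"
  unfolding fvec_def supp_def by (auto intro: finite_subset)

lemma fvec_finite: "F \<in> fvec B \<Longrightarrow> finite (supp F)"
  by (simp add: fvec_def)

lemma fvecD: "F \<in> fvec B \<Longrightarrow> F x \<noteq> 0 \<Longrightarrow> x \<in> B"
  by (auto simp: fvec_def supp_def)

lemma fvec_mono: "F \<in> fvec B \<Longrightarrow> B \<subseteq> C \<Longrightarrow> F \<in> fvec C"
  by (auto simp: fvec_def)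

lemma delta_in_fvec [simp]: "(delta b :: 'b \<Rightarrow> 'a::zero_neq_one) \<in> fvec B \<longleftrightarrow> b \<in> B"
  by (auto simp: fvec_def)

lemma fvec_zero [simp]: "(\<lambda>w. 0) \<in> fvec B"
  by (simp add: fvec_def supp_def)

lemma fvec_add [intro]:
  fixes F G :: "'b \<Rightarrow> 'a::monoid_add"
  assumes "F \<in> fvec B" "G \<in> fvec B"
  shows "(\<lambda>w. F w + G w) \<in> fvec B"
  by (rule fvecI[of "supp F \<union> supp G"]) (use assms in \<open>auto simp: fvec_def supp_def\<close>)

lemma fvec_scale [intro]:
  fixes F :: "'b \<Rightarrow> 'a::mult_zero"
  assumes "F \<in> fvec B"
  shows "(\<lambda>w. c * F w) \<in> fvec B"
  by (rule fvecI[of "supp F"]) (use assms in \<open>auto simp: fvec_def supp_def\<close>)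

lemma fvec_uminus [intro]:
  fixes F :: "'b \<Rightarrow> 'a::group_add"
  shows "F \<in> fvec B \<Longrightarrow> (\<lambda>w. - F w) \<in> fvec B"
  by (simp add: fvec_def supp_def)

lemma fvec_sum [intro]:
  fixes F :: "'c \<Rightarrow> 'b \<Rightarrow> 'a::comm_monoid_add"
  shows "(\<And>i. i \<in> A \<Longrightarrow> F i \<in> fvec B) \<Longrightarrow> (\<lambda>w. \<Sum>i\<in>A. F i w) \<in> fvec B"
  by (induction A rule: infinite_finite_induct) auto

lemma fvec_lin [intro]:
  "(\<And>b. F b \<noteq> 0 \<Longrightarrow> phi b \<in> fvec C) \<Longrightarrow> lin F phi \<in> fvec C"
  unfolding lin_def by (intro fvec_sum fvec_scale) (auto simp: supp_def)

lemma fvec_prepend [intro]: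
  assumes "F \<in> fvec B"
  shows "prepend x F \<in> fvec ((#) x ` B)"
  by (rule fvecI[of "(#) x ` supp F"])
     (use assms in \<open>auto simp: fvec_def supp_def elim: prepend_nonzeroE\<close>)

lemma sh_in_fvec:
  assumes "u \<in> valid_words" "v \<in> valid_words"
  shows "sh u v \<in> fvec {w \<in> valid_words. wt w = wt u + wt v}"
  by (rule fvecI[OF finite_valid_words_wt order_refl]) (use sh_support assms in blast)

lemma sh_fvec_valid [intro]:
  "u \<in> valid_words \<Longrightarrow> v \<in> valid_words \<Longrightarrow> sh u v \<in> fvec valid_words"
  by (erule (1) fvec_mono[OF sh_in_fvec]) auto

lemma shuffle_mult_lin: "shuffle_mult F G = lin F (\<lambda>u. lin G (sh u))"
  by (simp add: shuffle_mult_def lin_def sum_distrib_left mult.assoc)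

lemma Cop_lin: "Cop F = lin F cop"
  by (simp add: Cop_def lin_def)

lemma shuffle_mult_delta [simp]: "shuffle_mult (delta u) (delta v) = sh u v"
  by (simp add: shuffle_mult_lin)

lemma shuffle_mult_in_fvec:
  assumes "F \<in> fvec {w \<in> valid_words. wt w = m}" "G \<in> fvec {w \<in> valid_words. wt w = n}"
  shows "shuffle_mult F G \<in> fvec {w \<in> valid_words. wt w = m + n}"
  unfolding shuffle_mult_lin
proof (intro fvec_lin)
  fix u v assume "F u \<noteq> 0" "G v \<noteq> 0"
  with assms have "u \<in> valid_words \<and> wt u = m" "v \<in> valid_words \<and> wt v = n"
    by (auto dest: fvecD)
  then show "sh u v \<in> fvec {w \<in> valid_words. wt w = m + n}"
    using sh_in_fvec[of u v] by simp
qed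

lemma shuffle_mult_fvec_valid [intro]:
  "F \<in> fvec valid_words \<Longrightarrow> G \<in> fvec valid_words \<Longrightarrow> shuffle_mult F G \<in> fvec valid_words"
  unfolding shuffle_mult_lin by (intro fvec_lin sh_fvec_valid) (auto dest: fvecD)

section \<open>Support of the coproduct\<close>

lemma bracket_in_fvec:
  assumes "a \<in> valid_words"
  shows "bracket a \<in> fvec {w \<in> valid_words. wt w = wt a}"
proof -
  have "foldr (\<lambda>l. shuffle_mult (delta [l])) a (delta []) \<in> fvec {w \<in> valid_words. wt w = wt a}"
    using assms by (induction a) (auto intro!: shuffle_mult_in_fvec)
  then show ?thesis unfolding bracket_def by (rule fvec_scale)
qed

definition tensor :: "('b \<Rightarrow> 'a::times) \<Rightarrow> ('c \<Rightarrow> 'a) \<Rightarrow> 'b \<times> 'c \<Rightarrow> 'a" where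
  "tensor F G = (\<lambda>p. F (fst p) * G (snd p))"

lemma fvec_tensor [intro]:
  fixes F :: "'b \<Rightarrow> 'a::mult_zero"
  assumes "F \<in> fvec B" "G \<in> fvec C"
  shows "tensor F G \<in> fvec (B \<times> C)"
proof (rule fvecI)
  show "finite (supp F \<times> supp G)" "supp F \<times> supp G \<subseteq> B \<times> C"
    using assms by (auto simp: fvec_def)
  show "p \<in> supp F \<times> supp G" if "tensor F G p \<noteq> 0" for p
    using that by (cases p) (auto simp: tensor_def supp_def)
qed

abbreviation pairs_wt :: "nat \<Rightarrow> ('a::{field,finite} word \<times> 'a word) set" where
  "pairs_wt n \<equiv> {p. fst p \<in> valid_words \<and> snd p \<in> valid_words \<and> wt (fst p) + wt (snd p) = n}"

lemma copL_lin: "copL x = (\<lambda>p. \<Sum>r\<in>{1..fst x}. \<Sum>a\<in>ones (fst x - r).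
    of_nat ((r + length a - 2) choose length a) * tensor (delta [(r, snd x)]) (bracket a) p)"
  by (simp add: copL_def tensor_def mult.assoc)

lemma copL_in_fvec:
  assumes "snd x \<noteq> 0"
  shows "copL x \<in> fvec ((\<lambda>r. [(r, snd x)]) ` {1..fst x} \<times> valid_words)"
    and "copL x \<in> fvec (pairs_wt (fst x))"
proof -
  have *: "tensor (delta [(r, snd x)]) (bracket a) \<in> fvec ({[(r, snd x)]} \<times> {w \<in> valid_words. wt w = fst x - r})"
    if "a \<in> ones (fst x - r)" for r a
  proof (rule fvec_tensor)
    from that ones_subset have "a \<in> valid_words" "wt a = fst x - r" by auto
    with bracket_in_fvec[of a]
    show "bracket a \<in> fvec {w \<in> valid_words. wt w = fst x - r}" by simp
  qed simp
  show "copL x \<in> fvec ((\<lambda>r. [(r, snd x)]) ` {1..fst x} \<times> valid_words)"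
    unfolding copL_lin by (intro fvec_sum fvec_scale, rule fvec_mono, erule *) auto
  show "copL x \<in> fvec (pairs_wt (fst x))"
    unfolding copL_lin by (intro fvec_sum fvec_scale, rule fvec_mono, erule *) (use assms in auto)
qed

definition concat_sh :: "'a::{field,finite} word \<times> 'a word \<Rightarrow> 'a word \<times> 'a word \<Rightarrow> 'a word \<times> 'a word \<Rightarrow> 'a"
  where "concat_sh q q' = tensor (delta (fst q @ fst q')) (sh (snd q) (snd q'))"

lemma cop_Cons: "cop (x # v) =
  (\<lambda>p. delta ([], x # v) p + lin (copL x) (\<lambda>q. lin (cop v) (concat_sh q)) p)"
  by (simp add: lin_def concat_sh_def tensor_def sum_distrib_left mult.assoc)

lemma cop_in_fvec: "w \<in> valid_words \<Longrightarrow> cop w \<in> fvec (pairs_wt (wt w))"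
proof (induction w)
  case (Cons x v)
  have "lin (copL x) (\<lambda>q. lin (cop v) (concat_sh q)) \<in> fvec (pairs_wt (wt (x # v)))"
  proof (intro fvec_lin)
    fix q q' assume "copL x q \<noteq> 0" "cop v q' \<noteq> 0"
    then have q: "q \<in> pairs_wt (fst x)" "q' \<in> pairs_wt (wt v)"
      using copL_in_fvec(2)[of x] Cons by (auto dest: fvecD)
    have "concat_sh q q' \<in> fvec ({fst q @ fst q'} \<times> {w \<in> valid_words. wt w = wt (snd q) + wt (snd q')})"
      unfolding concat_sh_def by (intro fvec_tensor sh_in_fvec) (use q in auto)
    then show "concat_sh q q' \<in> fvec (pairs_wt (wt (x # v)))"
      by (rule fvec_mono) (use q in auto)
  qed
  then show ?case unfolding cop_Cons using Cons by (intro fvec_add) auto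
qed simp

lemma cop_fvec_valid [intro]: "w \<in> valid_words \<Longrightarrow> cop w \<in> fvec (valid_words \<times> valid_words)"
  by (erule fvec_mono[OF cop_in_fvec]) auto

lemma Cop_fvec_valid [intro]: "F \<in> fvec valid_words \<Longrightarrow> Cop F \<in> fvec (valid_words \<times> valid_words)"
  unfolding Cop_lin by (intro fvec_lin cop_fvec_valid) (auto dest: fvecD)

section \<open>Frobenius on finite fields\<close>

text \<open>Multiplication by a nonzero x permutes the nonzero elements, so their product P
  satisfies x^(q-1) P = P.\<close>

lemma finite_field_power_card:
  fixes x :: "'a::{field,finite}"
  shows "x ^ CARD('a) = x"
proof (cases "x = 0")
  case False
  let ?P = "\<Prod>y\<in>UNIV - {0 :: 'a}. y"
  have "bij_betw ((*) x) (UNIV - {0}) (UNIV - {0})"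
    by (rule bij_betw_byWitness[of _ "\<lambda>y. y / x"]) (use False in auto)
  then have "(\<Prod>y\<in>UNIV - {0}. x * y) = ?P"
    by (rule prod.reindex_bij_betw)
  then have "x ^ (CARD('a) - 1) * ?P = ?P"
    by (simp add: prod.distrib card_Diff_singleton)
  then have "x ^ (CARD('a) - 1) = 1" by simp
  then show ?thesis
    by (metis finite_UNIV_card_ge_0 finite mult.right_neutral power_eq_if nat_neq_iff)
qed (simp add: zero_power)

lemma card_field_ge_2: "CARD('a::{field,finite}) \<ge> 2"
proof -
  have "card {0, 1 :: 'a} \<le> CARD('a)" by (rule card_mono) auto
  then show ?thesis by simp
qed

text \<open>The polynomial \<open>(1 + X)\<^sup>q - X\<^sup>q - 1\<close> has degree below \<open>q\<close> and vanishes on the whole field.\<close>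
lemma of_nat_card_choose:
  assumes "0 < i" "i < CARD('a::{field,finite})"
  shows "(of_nat (CARD('a) choose i) :: 'a) = 0"
proof -
  let ?q = "CARD('a)"
  let ?p = "[:1, 1 :: 'a:] ^ ?q - monom 1 ?q"
  have coeff: "coeff ([:1, 1 :: 'a:] ^ ?q) n = of_nat (?q choose n)" if "n \<le> ?q" for n
    using that by (simp add: coeff_linear_poly_power)
  have deg: "degree ?p < ?q"
  proof (rule degree_lessI)
    show "\<forall>k\<ge>?q. coeff ?p k = 0"
    proof (intro allI impI)
      fix k assume "?q \<le> k"
      moreover have "coeff ([:1, 1 :: 'a:] ^ ?q) k = 0" if "k > ?q"
        using that degree_linear_power[of "1::'a" ?q] by (intro coeff_eq_0) simp
      ultimately show "coeff ?p k = 0"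
        by (cases "k = ?q") (simp_all add: coeff)
    qed
  qed (use card_field_ge_2[where 'a='a] in auto)
  have "?p = 1"
  proof (rule poly_eqI_degree[of UNIV])
    fix x :: 'a
    show "poly ?p x = poly 1 x"
      by (simp add: poly_power poly_monom finite_field_power_card)
  qed (use deg card_field_ge_2[where 'a='a] in auto)
  then have "coeff ?p i = coeff 1 i" by simp
  then show ?thesis using assms by (simp add: coeff)
qed

text \<open>Only the two extreme binomial terms survive. The ring is kept general because both
  scalars and power series are substituted.\<close>

lemma power_card_add:
  fixes x y :: "'r::comm_ring_1"
  assumes "\<And>i. 0 < i \<Longrightarrow> i < q \<Longrightarrow> of_nat (q choose i) = (0 :: 'r)" and "q > 0"
  shows "(x + y) ^ q = x ^ q + y ^ q"
proof -
  have "(x + y) ^ q = (\<Sum>i\<le>q. of_nat (q choose i) * x ^ i * y ^ (q - i))"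
    by (rule binomial_ring)
  also have "\<dots> = (\<Sum>i\<in>{0, q}. of_nat (q choose i) * x ^ i * y ^ (q - i))"
    by (rule sum.mono_neutral_right) (use assms in auto)
  finally show ?thesis using assms(2) by simp
qed

lemma mod_add_left_cancel_nat: "(i + a) mod m = (i + b) mod m \<longleftrightarrow> a mod m = b mod m" for a b i m :: nat
proof -
  have "(i + a) mod m = (i + b) mod m \<longleftrightarrow> int (i + a) mod int m = int (i + b) mod int m"
    by (simp only: zmod_int[symmetric] of_nat_eq_iff)
  also have "\<dots> \<longleftrightarrow> int a mod int m = int b mod int m"
    by (simp add: mod_eq_dvd_iff)
  finally show ?thesis by (simp only: zmod_int[symmetric] of_nat_eq_iff)
qed

section \<open>The flag model\<close>

type_synonym 'k flag = "('k \<times> nat) list"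

locale flag_model =
  fixes \<iota> :: "'a::{field,finite} \<Rightarrow> 'k::field" and q :: nat
  assumes \<iota>_add: "\<iota> (x + y) = \<iota> x + \<iota> y"
    and \<iota>_mult: "\<iota> (x * y) = \<iota> x * \<iota> y"
    and \<iota>_1 [simp]: "\<iota> 1 = 1"
    and infinite_UNIV: "infinite (UNIV :: 'k set)"
    and q_eq: "q = CARD('a)"
begin

abbreviation q1 :: nat where "q1 \<equiv> q - Suc 0"

lemma q_ge_2: "q \<ge> 2" unfolding q_eq by (rule card_field_ge_2)

lemma q1_pos [simp]: "0 < q1" using q_ge_2 by linarith

lemma Suc_q1 [simp]: "Suc q1 = q" using q_ge_2 by linarith

lemma \<iota>_0 [simp]: "\<iota> 0 = 0"
  using \<iota>_add[of 0 0] by (metis add.right_neutral add_left_cancel)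

lemma \<iota>_uminus: "\<iota> (- x) = - \<iota> x"
  using \<iota>_add[of x "- x"] by (simp add: eq_neg_iff_add_eq_0 add.commute)

lemma \<iota>_eq_0_iff [simp]: "\<iota> x = 0 \<longleftrightarrow> x = 0"
proof
  show "x = 0" if "\<iota> x = 0"
    using \<iota>_mult[of x "inverse x"] that by (cases "x = 0") auto
qed simp

lemma \<iota>_eq_iff: "\<iota> x = \<iota> y \<longleftrightarrow> x = y"
proof -
  have "\<iota> (x - y) = \<iota> x - \<iota> y"
    using \<iota>_add[of x "- y"] by (simp add: \<iota>_uminus)
  then show ?thesis using \<iota>_eq_0_iff[of "x - y"] by simp
qed

lemma \<iota>_power: "\<iota> (x ^ n) = \<iota> x ^ n"
  by (induction n) (simp_all add: \<iota>_mult)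

lemma \<iota>_of_nat: "\<iota> (of_nat n) = of_nat n"
  by (induction n) (simp_all add: \<iota>_add)

lemma of_nat_q_choose: "0 < i \<Longrightarrow> i < q \<Longrightarrow> of_nat (q choose i) = (0 :: 'k)"
  using of_nat_card_choose[where 'a='a] \<iota>_of_nat unfolding q_eq by (metis \<iota>_0)

lemma frobenius_add: "(x + y :: 'k) ^ q = x ^ q + y ^ q"
  by (rule power_card_add) (use of_nat_q_choose q_ge_2 in auto)

lemma fps_frobenius_add: "(f + g :: 'k fps) ^ q = f ^ q + g ^ q"
  by (rule power_card_add)
     (use q_ge_2 in \<open>auto simp only: fps_of_nat[symmetric] of_nat_q_choose fps_const_0_eq_0\<close>)

lemma minus_1_power: "q1 dvd j \<Longrightarrow> (- 1 :: 'k) ^ j = 1"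
proof -
  have "(- 1 :: 'k) ^ q1 = 1"
  proof -
    \<comment> \<open>Additivity of Frobenius avoids a case split on the parity of q.\<close>
    have "0 = (1 + - 1 :: 'k) ^ q" using q_ge_2 by (simp add: zero_power)
    also have "\<dots> = 1 + (- 1) ^ Suc q1" by (simp only: frobenius_add Suc_q1 power_one)
    finally have "0 = 1 + (- 1 :: 'k) * (- 1) ^ q1" by (simp only: power_Suc)
    then show ?thesis by simp
  qed
  then show "q1 dvd j \<Longrightarrow> (- 1 :: 'k) ^ j = 1"
    by (auto simp: power_mult elim!: dvdE)
qed

text \<open>Each entry \<open>(y, k)\<close> of a flag is one level, the topmost level coming first: \<open>y\<close> is the power
  sum \<open>S_d(1)\<close> of that level and \<open>k\<close> selects the character \<open>\<epsilon> \<mapsto> \<epsilon>\<^sup>k\<close>. The series \<open>exf\<close> is the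
  normalised additive polynomial of the space spanned by the levels, and the coefficient of \<open>X\<^bsup>n-1\<^esup>\<close>
  in \<open>psum y ys\<close> is the power sum \<open>S_d(n)\<close> of a level \<open>y\<close> lying above \<open>ys\<close>.\<close>
primrec exf :: "'k flag \<Rightarrow> 'k fps" where
  "exf [] = fps_X"
| "exf (z # ys) = exf ys - fps_const (fst z ^ q1) * exf ys ^ q"

definition psum :: "'k \<Rightarrow> 'k flag \<Rightarrow> 'k fps" where
  "psum y ys = fps_const y / (1 - fps_const y * exf ys)"

definition top_ev :: "'k \<times> nat \<Rightarrow> 'k flag \<Rightarrow> ('a word \<Rightarrow> 'k) \<Rightarrow> 'a word \<Rightarrow> 'k" where
  "top_ev z ys f w = (case w of [] \<Rightarrow> 0
     | x # v \<Rightarrow> \<iota> (snd x) ^ snd z * psum (fst z) ys $ (fst x - 1) * f v)"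

text \<open>The first summand covers the words placed entirely below the top level, the second those
  whose first letter sits on it. A level carries at most one letter, so the tail is evaluated on
  \<open>ys\<close>. On the empty flag only the empty word survives: \<open>ev []\<close> is the
  counit.\<close>

primrec ev :: "'k flag \<Rightarrow> 'a word \<Rightarrow> 'k" where
  "ev [] w = (if w = [] then 1 else 0)"
| "ev (z # ys) w = ev ys w + top_ev z ys (ev ys) w"

lemma top_ev_simps [simp]:
  "top_ev z ys f [] = 0"
  "top_ev z ys f (x # v) = \<iota> (snd x) ^ snd z * psum (fst z) ys $ (fst x - 1) * f v"
  by (simp_all add: top_ev_def)

lemma ev_Nil [simp]: "ev ys [] = 1"
  by (induction ys) simp_all

lemma exf_nth_0 [simp]: "exf ys $ 0 = 0"
  using q_ge_2 by (induction ys) (auto simp: fps_power_zeroth zero_power)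

lemma exf_power_nth_less: "n < k \<Longrightarrow> (exf ys ^ k) $ n = 0"
  using startsby_zero_power_prefix[of "exf ys" k] by simp

lemma exf_nth_1 [simp]: "exf ys $ Suc 0 = 1"
  using q_ge_2 by (induction ys) (auto simp: exf_power_nth_less)

lemma exf_power_nth_diag: "(exf ys ^ n) $ n = 1"
  using startsby_zero_power_nth_same[of "exf ys" n] by simp

lemma psum_mult: "psum y ys * (1 - fps_const y * exf ys) = fps_const y"
  by (simp add: psum_def fps_divide_unit mult.assoc inverse_mult_eq_1)

text \<open>Each level acts by a map T -> T - c T^q, so stacking levels composes series and a cut of
  the flag becomes a composition.\<close>

lemma exf_append: "exf (zs @ ys) = exf zs oo exf ys"
  by (induction zs)
     (simp_all add: fps_compose_sub_distrib fps_compose_mult_distrib fps_compose_power)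

lemma psum_append: "psum y (zs @ ys) = psum y zs oo exf ys"
proof -
  have "(psum y zs oo exf ys) * (1 - fps_const y * exf (zs @ ys)) = fps_const y"
    using arg_cong[OF psum_mult, of "\<lambda>f. f oo exf ys"]
    by (simp add: exf_append fps_compose_sub_distrib fps_compose_mult_distrib)
  moreover have "1 - fps_const y * exf (zs @ ys) \<noteq> 0"
    by (rule fps_nonzeroI[of _ 0]) simp
  ultimately show ?thesis
    using psum_mult[of y "zs @ ys"] by (metis mult_right_cancel)
qed

text \<open>The geometric series in y X of the empty flag is composed with \<open>exf ys\<close>.
  This exhibits a polynomial in y, of degree n + 1 when y is varied, which is what the independence
  proof uses.\<close>

lemma psum_nth: "psum y ys $ n = (\<Sum>k\<le>n. y ^ Suc k * (exf ys ^ k) $ n)"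
proof -
  have "psum y [] $ k = y ^ Suc k" for k
  proof -
    have "Abs_fps (\<lambda>k. y ^ Suc k) * (1 - fps_const y * fps_X) = fps_const y"
    proof (rule fps_ext)
      fix n
      have "Abs_fps (\<lambda>k. y ^ Suc k) * (1 - fps_const y * fps_X)
        = Abs_fps (\<lambda>k. y ^ Suc k) - fps_const y * (Abs_fps (\<lambda>k. y ^ Suc k) * fps_X)"
        by (simp add: algebra_simps)
      then show "(Abs_fps (\<lambda>k. y ^ Suc k) * (1 - fps_const y * fps_X)) $ n = fps_const y $ n"
        by (cases n) simp_all
    qed
    moreover have "1 - fps_const y * fps_X \<noteq> 0"
      by (rule fps_nonzeroI[of _ 0]) simp
    ultimately have "psum y [] = Abs_fps (\<lambda>k. y ^ Suc k)"
      using psum_mult[of y "[]"] by (metis exf.simps(1) mult_right_cancel)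
    then show ?thesis by simp
  qed
  then show ?thesis
    using psum_append[of y "[]" ys] by (simp add: fps_compose_nth atMost_atLeast0)
qed

subsection \<open>The inverse of the additive series\<close>

definition smod :: "nat \<Rightarrow> 'k fps \<Rightarrow> bool" where
  "smod r f \<longleftrightarrow> (\<forall>n. f $ n \<noteq> 0 \<longrightarrow> n mod q1 = r mod q1)"

definition proj_mod :: "nat \<Rightarrow> 'k fps \<Rightarrow> 'k fps" where
  "proj_mod r f = Abs_fps (\<lambda>n. if n mod q1 = r mod q1 then f $ n else 0)"

lemma smod_mult:
  assumes "smod r f" "smod s g"
  shows "smod (r + s) (f * g)"
  unfolding smod_def
proof (intro allI impI)
  fix n assume "(f * g) $ n \<noteq> 0"
  then obtain i where i: "i \<in> {0..n}" "f $ i * g $ (n - i) \<noteq> 0"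
    unfolding fps_mult_nth by (rule sum.not_neutral_contains_not_neutral)
  then have "i mod q1 = r mod q1" "(n - i) mod q1 = s mod q1"
    using assms by (auto simp: smod_def)
  then have "(i + (n - i)) mod q1 = (r + s) mod q1" by (rule mod_add_cong)
  then show "n mod q1 = (r + s) mod q1" using i by simp
qed

lemma smod_power: "smod r f \<Longrightarrow> smod (n * r) (f ^ n)"
proof (induction n)
  case (Suc n)
  then show ?case using smod_mult[of r f "n * r" "f ^ n"] by simp
qed (simp add: smod_def)

lemma smod_const: "smod 0 (fps_const c)"
  by (simp add: smod_def)

lemma smod_diff: "smod r f \<Longrightarrow> smod r g \<Longrightarrow> smod r (f - g)"
  unfolding smod_def by (intro allI) (case_tac "f $ n = 0", auto)

lemma smod_cong: "r mod q1 = s mod q1 \<Longrightarrow> smod r f \<longleftrightarrow> smod s f"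
  by (simp add: smod_def)

lemma smod_exf: "smod 1 (exf ys)"
proof (induction ys)
  case (Cons z ys)
  have "smod (0 + q * 1) (fps_const (fst z ^ q1) * exf ys ^ q)"
    by (intro smod_mult smod_power smod_const Cons)
  moreover have "(0 + q * 1) mod q1 = 1 mod q1"
    by (metis Suc_q1 add_0 mod_add_self2 mult.right_neutral plus_1_eq_Suc)
  ultimately have "smod 1 (fps_const (fst z ^ q1) * exf ys ^ q)"
    by (rule smod_cong[THEN iffD1, rotated])
  then show ?case
    unfolding exf.simps by (intro smod_diff Cons)
qed (simp add: smod_def fps_X_def)

text \<open>A factor supported in a single residue class only shifts residue classes.\<close>

lemma proj_mod_mult:
  assumes "smod s f"
  shows "proj_mod (s + r) (f * g) = f * proj_mod r g"
proof (rule fps_ext)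
  fix n
  have "f $ i * proj_mod r g $ (n - i) = (if n mod q1 = (s + r) mod q1 then f $ i * g $ (n - i) else 0)"
    if "i \<in> {0..n}" for i
  proof (cases "f $ i = 0")
    case False
    then have i: "i mod q1 = s mod q1" using assms by (simp add: smod_def)
    have "n mod q1 = (s + r) mod q1 \<longleftrightarrow> (i + (n - i)) mod q1 = (i + r) mod q1"
      using that i by (metis atLeastAtMost_iff le_add_diff_inverse mod_add_left_eq)
    also have "\<dots> \<longleftrightarrow> (n - i) mod q1 = r mod q1"
      by (rule mod_add_left_cancel_nat)
    finally show ?thesis by (simp add: proj_mod_def)
  qed simp
  then show "proj_mod (s + r) (f * g) $ n = (f * proj_mod r g) $ n"
    by (simp add: fps_mult_nth proj_mod_def)
qed

lemma proj_mod_smod: "smod s f \<Longrightarrow> proj_mod r f = (if s mod q1 = r mod q1 then f else 0)"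
  by (auto simp: proj_mod_def smod_def fps_eq_iff)

lemma proj_mod_sum: "proj_mod r (\<Sum>i\<in>A. f i) = (\<Sum>i\<in>A. proj_mod r (f i))"
  by (rule fps_ext) (simp add: proj_mod_def fps_sum_nth)

text \<open>Multiplication by 1 - (y e)^(q-1) turns the geometric series of \<open>psum\<close> into
  y times the sum of (y e)^k over k < q - 1. The exponents in (y e)^k are congruent to k modulo q -
  1, so the projection keeps only k = q - 2.\<close>

lemma proj_mod_psum:
  "proj_mod (q1 - 1) (psum y ys) * (1 - (fps_const y * exf ys) ^ q1)
    = fps_const y * (fps_const y * exf ys) ^ (q1 - 1)"
proof -
  let ?e = "fps_const y * exf ys"
  have e: "smod 1 ?e" using smod_mult[OF smod_const smod_exf] by simp
  have e0: "smod 0 (1 - ?e ^ q1)"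
    using smod_power[OF e, of q1] smod_const[of 1] smod_cong[of q1 0 "?e ^ q1"]
    by (auto intro: smod_diff)
  have "psum y ys * (1 - ?e ^ q1) = fps_const y * (\<Sum>k<q1. ?e ^ k)"
    by (simp only: one_diff_power_eq mult.assoc[symmetric] psum_mult)
  then have "(1 - ?e ^ q1) * psum y ys = fps_const y * (\<Sum>k<q1. ?e ^ k)"
    by (simp only: mult.commute)
  then have "proj_mod (0 + (q1 - 1)) ((1 - ?e ^ q1) * psum y ys)
      = proj_mod (0 + (q1 - 1)) (fps_const y * (\<Sum>k<q1. ?e ^ k))"
    by simp
  then have "(1 - ?e ^ q1) * proj_mod (q1 - 1) (psum y ys)
      = fps_const y * (\<Sum>k<q1. proj_mod (q1 - 1) (?e ^ k))"
    unfolding proj_mod_mult[OF e0] proj_mod_mult[OF smod_const] proj_mod_sum .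
  also have "(\<Sum>k<q1. proj_mod (q1 - 1) (?e ^ k)) = (\<Sum>k<q1. if k = q1 - 1 then ?e ^ k else 0)"
  proof (rule sum.cong)
    fix k assume "k \<in> {..<q1}"
    then show "proj_mod (q1 - 1) (?e ^ k) = (if k = q1 - 1 then ?e ^ k else 0)"
      using proj_mod_smod[OF smod_power[OF e, of k], of "q1 - 1"] by simp
  qed simp
  finally show ?thesis using q1_pos by (simp add: mult.commute del: q1_pos)
qed

text \<open>These are the coefficients of X / e(X), as \<open>iexf_exf\<close> shows. Reading them
  off letters makes the coefficients that occur in products and coproducts values of words
  again.\<close>

definition iexf :: "'k flag \<Rightarrow> 'k fps" where
  "iexf ys = Abs_fps (\<lambda>j. if j = 0 then 1 else if q1 dvd j then ev ys [(j, 1)] else 0)"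

lemma iexf_Cons: "iexf (z # ys) = iexf ys + fps_X * proj_mod (q1 - 1) (psum (fst z) ys)"
proof (rule fps_ext)
  fix n
  show "iexf (z # ys) $ n = (iexf ys + fps_X * proj_mod (q1 - 1) (psum (fst z) ys)) $ n"
  proof (cases n)
    case (Suc j)
    \<comment> \<open>The coefficient of X^(n-1) in \<open>psum\<close> belongs to weight n, so
      multiples of q - 1 correspond to the residue class of q - 2.\<close>
    have "q1 dvd Suc j \<longleftrightarrow> j mod q1 = (q1 - 1) mod q1"
      using q1_pos by (auto simp: mod_Suc dvd_eq_mod_eq_0 simp del: q1_pos split: if_splits)
    then show ?thesis by (simp add: Suc iexf_def proj_mod_def)
  qed (simp add: iexf_def)
qed

text \<open>With w = (y e)^(q-1), a new level multiplies e by 1 - w and adds X P to the inverse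
  series, where P is the projection of \<open>psum\<close>. By \<open>proj_mod_psum\<close>, e P (1
  - w) = w, so the new product is X (1 - w) + X w = X.\<close>

lemma iexf_exf: "iexf ys * exf ys = fps_X"
proof (induction ys)
  case Nil
  have "iexf [] = 1" by (rule fps_ext) (simp add: iexf_def)
  then show ?case by simp
next
  case (Cons z ys)
  let ?y = "fps_const (fst z)" and ?e = "exf ys" and ?P = "proj_mod (q1 - 1) (psum (fst z) ys)"
  define w where "w = (?y * ?e) ^ q1"
  have w: "w = ?y * (?y * ?e) ^ (q1 - 1) * ?e"
    unfolding w_def using power_Suc[of "?y * ?e" "q1 - 1"] q1_pos
    by (simp only: Suc_diff_1 mult.assoc mult.left_commute mult.commute)
  have "fps_const (fst z ^ q1) * ?e ^ q = ?e * w"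
    using power_Suc[of ?e q1]
    by (simp only: w_def Suc_q1 power_mult_distrib fps_const_power mult.left_commute)
  then have ex: "exf (z # ys) = ?e * (1 - w)"
    by (simp only: exf.simps right_diff_distrib mult_1_right)
  have "iexf (z # ys) * exf (z # ys) = (iexf ys * ?e) * (1 - w) + fps_X * ?e * (?P * (1 - w))"
    unfolding iexf_Cons ex by (simp only: distrib_left distrib_right mult.assoc mult.left_commute)
  also have "\<dots> = fps_X * (1 - w) + fps_X * w"
    unfolding Cons w_def proj_mod_psum unfolding w_def[symmetric] w by (simp only: mult_ac)
  finally show ?case by (simp only: right_diff_distrib mult_1_right diff_add_cancel)
qed

subsection \<open>Products of power sums\<close>

abbreviation rescale :: "'k \<Rightarrow> 'k fps \<Rightarrow> 'k fps" where
  "rescale c f \<equiv> f oo (fps_const c * fps_X)"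

lemma rescale_nth: "rescale c f $ n = c ^ n * f $ n"
  by (simp add: fps_compose_linear)

text \<open>Only scalars and q-th powers enter \<open>exf\<close>, so Frobenius carries additivity
  from level to level. Rescaling replaces X by c X, with c any element of the large field.\<close>

lemma exf_additive: "rescale (c + d) (exf ys) = rescale c (exf ys) + rescale d (exf ys)"
proof (induction ys)
  case Nil
  show ?case by (rule fps_ext) (simp add: rescale_nth)
next
  case (Cons z ys)
  let ?e = "\<lambda>c. rescale c (exf ys)"
  have *: "rescale c (exf (z # ys)) = ?e c - fps_const (fst z ^ q1) * ?e c ^ q" for c
    by (simp add: fps_compose_sub_distrib fps_compose_mult_distrib fps_compose_power del: fps_const_power)
  show ?case
    unfolding * Cons fps_frobenius_add by (simp only: distrib_left) (simp only: algebra_simps)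
qed

text \<open>The partial fraction expansion of \<open>1 / (A B)\<close> over \<open>A - B\<close>, in generating function form.\<close>
lemma psum_partial_fractions:
  "(rescale s (psum y ys) - psum y ys) * rescale (s - 1) (iexf ys)
    = fps_const (s - 1) * fps_X * (rescale s (psum y ys) * psum y ys)"
proof -
  let ?H = "psum y ys" and ?e = "exf ys"
  let ?U = "1 - fps_const y * ?e" and ?V = "1 - fps_const y * rescale s ?e"
  have U: "?H * ?U = fps_const y" by (rule psum_mult)
  have V: "rescale s ?H * ?V = fps_const y"
    using arg_cong[OF psum_mult, of "rescale s"]
    by (simp add: fps_compose_sub_distrib fps_compose_mult_distrib)
  have nz: "?U * ?V \<noteq> 0"
    by (rule fps_nonzeroI[of _ 0]) (simp add: rescale_nth)
  have alg: "(f - g) * (u * v) = (f * v) * u - (g * u) * v" for f g u v :: "'k fps"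
    by (simp add: algebra_simps)
  have alg': "(f * g * d) * (u * v) = (f * v) * ((g * u) * d)" for d f g u v :: "'k fps"
    by (simp only: mult_ac)
  have "(rescale s ?H - ?H) * (?U * ?V) = (rescale s ?H * ?V) * ?U - (?H * ?U) * ?V"
    by (rule alg)
  also have "\<dots> = fps_const y * (fps_const y * (rescale s ?e - ?e))"
    unfolding U V by (simp only: right_diff_distrib mult_1_right) simp
  also have "\<dots> = (rescale s ?H * ?H * (rescale s ?e - ?e)) * (?U * ?V)"
    unfolding alg' U V by (simp only: mult.assoc)
  finally have "rescale s ?H - ?H = rescale s ?H * ?H * (rescale s ?e - ?e)"
    using nz by (rule mult_right_cancel[THEN iffD1, rotated])
  \<comment> \<open>Additivity of e merges the difference into one series at (s - 1) X, which the
    factor \<open>iexf\<close> then cancels against X.\<close>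
  also have "rescale s ?e - ?e = rescale (s - 1) ?e"
  proof -
    have "rescale 1 ?e = ?e" by (rule fps_ext) (simp add: rescale_nth)
    then show ?thesis using exf_additive[of ys "s - 1" 1] by simp
  qed
  finally have "(rescale s ?H - ?H) * rescale (s - 1) (iexf ys)
      = rescale s ?H * ?H * (rescale (s - 1) ?e * rescale (s - 1) (iexf ys))"
    by (simp only: mult.assoc)
  also have "rescale (s - 1) ?e * rescale (s - 1) (iexf ys) = fps_const (s - 1) * fps_X"
    using arg_cong[OF iexf_exf[of ys], of "rescale (s - 1)"]
    by (simp add: fps_compose_mult_distrib mult.commute)
  finally show ?thesis by (simp only: mult.commute)
qed

lemma poly_eqI_infinite:
  fixes p r :: "'k poly"
  assumes "\<And>x. poly p x = poly r x"
  shows "p = r"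
proof (rule ccontr)
  assume "p \<noteq> r"
  then have "finite {x. poly (p - r) x = 0}" by (intro poly_roots_finite) simp
  then show False using assms infinite_UNIV by simp
qed

lemma coeff_diff_power: "coeff ([:- 1, 1 :: 'k:] ^ j) i = (- 1) ^ (j - i) * of_nat (j choose i)"
proof (cases "i \<le> j")
  case False
  then show ?thesis
    using degree_linear_power[of "- 1 :: 'k" j] by (simp add: coeff_eq_0 binomial_eq_0)
qed (simp add: coeff_linear_poly_power mult.commute)

text \<open>A nonzero coefficient forces q - 1 to divide j, and then (-1)^j = 1 in the field; for i
  > j the binomial vanishes.\<close>

lemma iexf_sign: "iexf ys $ j * (- 1) ^ (j - i) * of_nat (j choose i)
  = iexf ys $ j * (- 1) ^ i * of_nat (j choose i)"
proof (cases "i \<le> j \<and> q1 dvd j")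
  case True
  then have "(- 1 :: 'k) ^ (j - i) * (- 1) ^ i = 1"
    using minus_1_power[of j] by (simp flip: power_add)
  then have "(- 1 :: 'k) ^ (j - i) = (- 1) ^ i"
    by (metis minus_one_mult_self mult.assoc mult.left_neutral mult.right_neutral)
  then show ?thesis by simp
qed (auto simp: iexf_def binomial_eq_0)

text \<open>The coefficient of X^(a+b+1) in \<open>psum_partial_fractions\<close> is a polynomial
  identity in s; this is its coefficient at s^a. The factor s - 1 is not divided out, which leaves a
  difference of two neighbouring products.\<close>

lemma psum_diff:
  "(if a = 0 then 0 else psum y ys $ (a - 1) * psum y ys $ Suc b) - psum y ys $ a * psum y ys $ b
  = (\<Sum>j\<le>Suc (a + b). psum y ys $ (Suc (a + b) - j) * iexf ys $ j *
      ((- 1) ^ Suc b * of_nat (j choose Suc b) - (- 1) ^ a * of_nat (j choose a)))"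
proof -
  let ?H = "psum y ys" and ?m = "Suc (a + b)"
  let ?X = "[:- 1, 1 :: 'k:]"
  define L where "L = (\<Sum>j\<le>?m. smult (?H $ (?m - j) * iexf ys $ j) ((monom 1 (?m - j) - 1) * ?X ^ j))"
  define M where "M = (\<Sum>i\<le>a + b. monom (?H $ i * ?H $ (a + b - i)) i)"
  have "L = ?X * M"
  proof (rule poly_eqI_infinite)
    fix s
    have "poly L s = (rescale (s - 1) (iexf ys) * (rescale s ?H - ?H)) $ ?m"
      unfolding fps_mult_nth fps_sub_nth rescale_nth L_def poly_sum atMost_atLeast0
      by (rule sum.cong) (simp_all add: poly_monom algebra_simps)
    also have "\<dots> = ((rescale s ?H - ?H) * rescale (s - 1) (iexf ys)) $ ?m"
      by (simp only: mult.commute)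
    also have "\<dots> = (s - 1) * (rescale s ?H * ?H) $ (a + b)"
      unfolding psum_partial_fractions by (simp add: mult.assoc)
    also have "(rescale s ?H * ?H) $ (a + b) = poly M s"
      unfolding fps_mult_nth rescale_nth M_def poly_sum poly_monom atMost_atLeast0
      by (simp only: mult_ac)
    also have "(s - 1) * poly M s = poly (?X * M) s"
      by (simp add: algebra_simps)
    finally show "poly L s = poly (?X * M) s" .
  qed
  have M: "coeff M i = (if i \<le> a + b then ?H $ i * ?H $ (a + b - i) else 0)" for i
    unfolding M_def coeff_sum by simp
  have "coeff (?X * M) a = (if a = 0 then 0 else ?H $ (a - 1) * ?H $ Suc b) - ?H $ a * ?H $ b"
    by (cases a) (simp_all add: M Suc_diff_le)
  moreover have "coeff L a = (\<Sum>j\<le>?m. ?H $ (?m - j) * iexf ys $ j *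
      ((- 1) ^ Suc b * of_nat (j choose Suc b) - (- 1) ^ a * of_nat (j choose a)))"
    unfolding L_def coeff_sum
  proof (rule sum.cong)
    fix j assume j: "j \<in> {..?m}"
    \<comment> \<open>The relevant exponent of (s - 1)^j is a - (m - j) = j - (b + 1); symmetry of
      binomials turns it into b + 1.\<close>
    have "coeff (monom 1 (?m - j) * ?X ^ j) a = (- 1) ^ Suc b * of_nat (j choose Suc b)"
    proof (cases "?m - j \<le> a")
      case True
      then have le: "Suc b \<le> j" by simp
      have eq: "a - (?m - j) = j - Suc b" using le j by simp
      show ?thesis
        unfolding coeff_monom_mult coeff_diff_power eq
        using True le binomial_symmetric[OF le] by simp
    next
      case False
      then show ?thesis by (simp add: coeff_monom_mult binomial_eq_0)
    qed
    then have "coeff ((monom 1 (?m - j) - 1) * ?X ^ j) a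
      = (- 1) ^ Suc b * of_nat (j choose Suc b) - (- 1) ^ (j - a) * of_nat (j choose a)"
      by (simp only: left_diff_distrib mult_1_left coeff_diff coeff_diff_power)
    then show "coeff (smult (?H $ (?m - j) * iexf ys $ j) ((monom 1 (?m - j) - 1) * ?X ^ j)) a
      = ?H $ (?m - j) * iexf ys $ j * ((- 1) ^ Suc b * of_nat (j choose Suc b) - (- 1) ^ a * of_nat (j choose a))"
      using iexf_sign[of ys j a] by (simp only: coeff_smult right_diff_distrib mult.assoc)
  qed simp
  ultimately show ?thesis using \<open>L = ?X * M\<close> by simp
qed

text \<open>\<open>psum_diff\<close> moves one unit of weight from one factor to the other. For a =
  0 one of its products is missing and its term j = 0 is the main summand here; the induction step
  is Pascal's rule.\<close>

lemma psum_nth_mult: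
  "psum y ys $ a * psum y ys $ b = psum y ys $ Suc (a + b)
    + (\<Sum>k\<le>a + b. psum y ys $ (a + b - k) * iexf ys $ Suc k *
        ((- 1) ^ a * of_nat (k choose a) + (- 1) ^ b * of_nat (k choose b)))"
proof (induction a arbitrary: b)
  case 0
  have "- (psum y ys $ 0 * psum y ys $ b) = - psum y ys $ Suc b
    + (\<Sum>k\<le>b. psum y ys $ (b - k) * iexf ys $ Suc k * ((- 1) ^ Suc b * of_nat (Suc k choose Suc b) - 1))"
    using psum_diff[of 0 y ys b] by (simp add: sum.atMost_Suc_shift iexf_def[of ys] del: sum.atMost_Suc binomial_Suc_Suc)
  then have "psum y ys $ 0 * psum y ys $ b = psum y ys $ Suc b
    + (\<Sum>k\<le>b. - (psum y ys $ (b - k) * iexf ys $ Suc k * ((- 1) ^ Suc b * of_nat (Suc k choose Suc b) - 1)))"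
    by (simp only: sum_negf) (simp add: algebra_simps)
  also have "(\<Sum>k\<le>b. - (psum y ys $ (b - k) * iexf ys $ Suc k * ((- 1) ^ Suc b * of_nat (Suc k choose Suc b) - 1)))
    = (\<Sum>k\<le>b. psum y ys $ (b - k) * iexf ys $ Suc k * (1 + (- 1) ^ b * of_nat (k choose b)))"
    by (rule sum.cong) (auto simp: binomial_eq_0 algebra_simps)
  finally show ?case by simp
next
  case (Suc a)
  let ?m = "Suc (a + b)"
  have "psum y ys $ Suc a * psum y ys $ b = psum y ys $ a * psum y ys $ Suc b
    - (\<Sum>k\<le>?m. psum y ys $ (?m - k) * iexf ys $ Suc k *
      ((- 1) ^ Suc b * of_nat (Suc k choose Suc b) - (- 1) ^ Suc a * of_nat (Suc k choose Suc a)))"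
    using psum_diff[of "Suc a" y ys b]
    by (simp add: sum.atMost_Suc_shift[of _ ?m] del: sum.atMost_Suc binomial_Suc_Suc power_Suc)
       (simp only: algebra_simps)
  also have "psum y ys $ a * psum y ys $ Suc b = psum y ys $ Suc ?m
    + (\<Sum>k\<le>?m. psum y ys $ (?m - k) * iexf ys $ Suc k *
        ((- 1) ^ a * of_nat (k choose a) + (- 1) ^ Suc b * of_nat (k choose Suc b)))"
    using Suc.IH[of "Suc b"] by simp
  finally have "psum y ys $ Suc a * psum y ys $ b = psum y ys $ Suc ?m
    + ((\<Sum>k\<le>?m. psum y ys $ (?m - k) * iexf ys $ Suc k *
        ((- 1) ^ a * of_nat (k choose a) + (- 1) ^ Suc b * of_nat (k choose Suc b)))
    - (\<Sum>k\<le>?m. psum y ys $ (?m - k) * iexf ys $ Suc k *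
      ((- 1) ^ Suc b * of_nat (Suc k choose Suc b) - (- 1) ^ Suc a * of_nat (Suc k choose Suc a))))"
    by simp
  also have "((\<Sum>k\<le>?m. psum y ys $ (?m - k) * iexf ys $ Suc k *
        ((- 1) ^ a * of_nat (k choose a) + (- 1) ^ Suc b * of_nat (k choose Suc b)))
    - (\<Sum>k\<le>?m. psum y ys $ (?m - k) * iexf ys $ Suc k *
      ((- 1) ^ Suc b * of_nat (Suc k choose Suc b) - (- 1) ^ Suc a * of_nat (Suc k choose Suc a))))
    = (\<Sum>k\<le>?m. psum y ys $ (?m - k) * iexf ys $ Suc k *
        ((- 1) ^ Suc a * of_nat (k choose Suc a) + (- 1) ^ b * of_nat (k choose b)))"
    unfolding sum_subtractf[symmetric] right_diff_distrib[symmetric]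
    by (intro sum.cong arg_cong2[of _ _ _ _ "(*)"]) (simp_all add: algebra_simps)
  finally show ?case by simp
qed

text \<open>The passage from exponents of X to weights: with j = k + 1 the signed binomials of
  \<open>psum_nth_mult\<close> become \<open>Dc\<close>, and \<open>iexf\<close> supplies its
  divisibility condition.\<close>

lemma psum_product:
  assumes "a \<ge> 1" "b \<ge> 1"
  shows "psum y ys $ (a - 1) * psum y ys $ (b - 1) = psum y ys $ (a + b - 1)
    + (\<Sum>j\<in>{1..<a + b}. \<iota> (Dc j a b) * (psum y ys $ (a + b - j - 1) * ev ys [(j, 1)]))"
proof -
  obtain a' b' where ab: "a = Suc a'" "b = Suc b'" using assms by (metis One_nat_def Suc_le_D)
  have D: "iexf ys $ Suc k * ((- 1) ^ a' * of_nat (k choose a') + (- 1) ^ b' * of_nat (k choose b'))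
    = \<iota> (Dc (Suc k) a b) * ev ys [(Suc k, 1)]" for k
    by (simp add: Dc_def iexf_def ab \<iota>_add \<iota>_mult \<iota>_power \<iota>_uminus \<iota>_of_nat flip: q_eq)
  have "(\<Sum>j\<in>{1..<a + b}. \<iota> (Dc j a b) * (psum y ys $ (a + b - j - 1) * ev ys [(j, 1)]))
    = (\<Sum>k\<le>a' + b'. \<iota> (Dc (Suc k) a b) * (psum y ys $ (a' + b' - k) * ev ys [(Suc k, 1)]))"
    by (rule sum.reindex_bij_witness[of _ Suc "\<lambda>j. j - 1"]) (auto simp: ab)
  also have "\<dots> = (\<Sum>k\<le>a' + b'. psum y ys $ (a' + b' - k) * iexf ys $ Suc k *
        ((- 1) ^ a' * of_nat (k choose a') + (- 1) ^ b' * of_nat (k choose b')))"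
    by (simp only: mult.assoc D) (simp only: mult_ac)
  finally show ?thesis using psum_nth_mult[of y ys a' b'] by (simp add: ab)
qed

section \<open>Evaluation of vectors\<close>

text \<open>Vectors have coefficients in F_q while functionals take values in the large field, hence
  the embedding of each coefficient.\<close>

definition pair :: "('b \<Rightarrow> 'a) \<Rightarrow> ('b \<Rightarrow> 'k) \<Rightarrow> 'k" where
  "pair F \<phi> = (\<Sum>b\<in>supp F. \<iota> (F b) * \<phi> b)"

lemma pair_superset:
  assumes "finite A" "supp F \<subseteq> A"
  shows "pair F \<phi> = (\<Sum>b\<in>A. \<iota> (F b) * \<phi> b)"
  unfolding pair_def by (rule sum.mono_neutral_left) (use assms in \<open>auto simp: supp_def\<close>)

lemma pair_cong: "(\<And>b. F b \<noteq> 0 \<Longrightarrow> \<phi> b = \<psi> b) \<Longrightarrow> pair F \<phi> = pair F \<psi>"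
  unfolding pair_def by (rule sum.cong) (auto simp: supp_def)

lemma pair_fvec_cong: "F \<in> fvec B \<Longrightarrow> (\<And>b. b \<in> B \<Longrightarrow> \<phi> b = \<psi> b) \<Longrightarrow> pair F \<phi> = pair F \<psi>"
  by (rule pair_cong) (auto dest: fvecD)

lemma pair_delta [simp]: "pair (delta b) \<phi> = \<phi> b"
  unfolding pair_def supp_delta by (simp add: delta_def)

lemma pair_zero [simp]: "pair (\<lambda>b. 0) \<phi> = 0"
  by (simp add: pair_def supp_def)

lemma pair_add:
  assumes "F \<in> fvec B" "G \<in> fvec C"
  shows "pair (\<lambda>b. F b + G b) \<phi> = pair F \<phi> + pair G \<phi>"
proof -
  let ?A = "supp F \<union> supp G"
  have A: "finite ?A" using assms by (auto dest: fvec_finite)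
  have "supp (\<lambda>b. F b + G b) \<subseteq> ?A" by (auto simp: supp_def)
  then show ?thesis
    by (simp add: pair_superset[OF A] \<iota>_add distrib_right sum.distrib)
qed

lemma pair_scale: "pair (\<lambda>b. c * F b) \<phi> = \<iota> c * pair F \<phi>"
proof (cases "c = 0")
  case False
  then have "supp (\<lambda>b. c * F b) = supp F" by (auto simp: supp_def)
  then show ?thesis by (simp add: pair_def \<iota>_mult sum_distrib_left mult.assoc)
qed simp

lemma pair_uminus: "pair (\<lambda>b. - F b) \<phi> = - pair F \<phi>"
  using pair_scale[of "- 1" F \<phi>] by (simp add: \<iota>_uminus)

lemma pair_sum:
  assumes "\<And>i. i \<in> A \<Longrightarrow> F i \<in> fvec B"
  shows "pair (\<lambda>b. \<Sum>i\<in>A. F i b) \<phi> = (\<Sum>i\<in>A. pair (F i) \<phi>)"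
  using assms
proof (induction A rule: infinite_finite_induct)
  case (insert i A)
  then have "pair (\<lambda>b. F i b + (\<Sum>i\<in>A. F i b)) \<phi> = pair (F i) \<phi> + pair (\<lambda>b. \<Sum>i\<in>A. F i b) \<phi>"
    by (intro pair_add[of _ B _ B] fvec_sum) auto
  with insert show ?case by simp
qed simp_all

lemma pair_lin:
  assumes "\<And>b. F b \<noteq> 0 \<Longrightarrow> \<Phi> b \<in> fvec C"
  shows "pair (lin F \<Phi>) \<psi> = pair F (\<lambda>b. pair (\<Phi> b) \<psi>)"
  unfolding lin_def using assms
  by (subst pair_sum[of _ _ C]) (auto simp: pair_scale pair_def[of F] supp_def)

lemma pair_prepend:
  assumes "F \<in> fvec B"
  shows "pair (prepend x F) \<phi> = pair F (\<lambda>w. \<phi> (x # w))"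
proof -
  have fin: "finite ((#) x ` supp F)" using assms by (simp add: fvec_finite)
  have sub: "supp (prepend x F) \<subseteq> (#) x ` supp F"
    by (auto simp: supp_def elim: prepend_nonzeroE)
  show ?thesis
    unfolding pair_superset[OF fin sub] by (simp add: sum.reindex pair_def)
qed

lemma pair_tensor:
  assumes "F \<in> fvec B" "G \<in> fvec C"
  shows "pair (tensor F G) (\<lambda>p. \<phi> (fst p) * \<psi> (snd p)) = pair F \<phi> * pair G \<psi>"
proof -
  have fin: "finite (supp F \<times> supp G)" using assms by (simp add: fvec_finite)
  have sub: "supp (tensor F G) \<subseteq> supp F \<times> supp G" by (auto simp: supp_def tensor_def)
  show ?thesis
    unfolding pair_superset[OF fin sub] pair_def[of F] pair_def[of G] sum_product
    by (simp add: sum.cartesian_product tensor_def \<iota>_mult mult_ac split_beta)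
qed

lemma pair_const_mult: "pair F (\<lambda>b. c * \<phi> b) = c * pair F \<phi>"
  by (simp add: pair_def sum_distrib_left mult_ac)

lemma pair_mult_const: "pair F (\<lambda>b. \<phi> b * c) = pair F \<phi> * c"
  by (simp add: pair_def sum_distrib_right mult.assoc)

lemma pair_add_right: "pair F (\<lambda>b. \<phi> b + \<psi> b) = pair F \<phi> + pair F \<psi>"
  by (simp add: pair_def distrib_left sum.distrib)

lemma pair_diff_right: "pair F (\<lambda>b. \<phi> b - \<psi> b) = pair F \<phi> - pair F \<psi>"
  by (simp add: pair_def right_diff_distrib sum_subtractf)

lemma pair_sum_right: "pair F (\<lambda>b. \<Sum>i\<in>A. \<phi> i b) = (\<Sum>i\<in>A. pair F (\<phi> i))"
  unfolding pair_def sum_distrib_left by (rule sum.swap)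

lemma pair_zero_right: "(\<And>b. F b \<noteq> 0 \<Longrightarrow> \<phi> b = 0) \<Longrightarrow> pair F \<phi> = 0"
  by (simp add: pair_def supp_def)

section \<open>Evaluations are characters of the shuffle algebra\<close>

lemma pair_add4:
  assumes "A \<in> fvec UNIV" "B \<in> fvec UNIV" "C \<in> fvec UNIV" "\<And>j. j \<in> J \<Longrightarrow> S j \<in> fvec UNIV"
  shows "pair (\<lambda>w. A w + B w + C w + (\<Sum>j\<in>J. S j w)) \<phi>
    = pair A \<phi> + pair B \<phi> + pair C \<phi> + (\<Sum>j\<in>J. pair (S j) \<phi>)"
  using assms by (simp add: pair_add[of _ UNIV _ UNIV] pair_sum[of _ _ UNIV] fvec_add fvec_sum)

text \<open>The functional is arbitrary because it is instantiated with \<open>top_ev\<close>, which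
  is not multiplicative by itself.\<close>

lemma pair_sh_Cons:
  assumes "x # u \<in> valid_words" "y # v \<in> valid_words"
  shows "pair (sh (x # u) (y # v)) \<phi> =
    pair (sh u (y # v)) (\<lambda>w. \<phi> (x # w)) + pair (sh (x # u) v) (\<lambda>w. \<phi> (y # w))
    + pair (sh u v) (\<lambda>w. \<phi> ((fst x + fst y, snd x * snd y) # w))
    + (\<Sum>j\<in>{1..<fst x + fst y}. \<iota> (Dc j (fst x) (fst y)) *
        pair (sh u v) (\<lambda>b. pair (sh [(j, 1)] b) (\<lambda>w. \<phi> ((fst x + fst y - j, snd x * snd y) # w))))"
proof -
  have sh: "sh u (y # v) \<in> fvec valid_words" "sh (x # u) v \<in> fvec valid_words" "sh u v \<in> fvec valid_words"
    using assms by auto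
  have sh1: "sh [(j, 1)] b \<in> fvec valid_words" if "sh u v b \<noteq> 0" "j \<in> {1..<fst x + fst y}" for b j
    using that sh(3) by (auto dest: fvecD)
  have lin: "lin (sh u v) (sh [(j, 1)]) \<in> fvec valid_words" if "j \<in> {1..<fst x + fst y}" for j
    using that by (intro fvec_lin sh1)
  have pre: "prepend z F \<in> fvec UNIV" if "F \<in> fvec valid_words" for z and F :: "'a word \<Rightarrow> 'a"
    using that by (rule fvec_mono[OF fvec_prepend]) simp
  let ?s = "(\<lambda>j w. Dc j (fst x) (fst y) *
          prepend (fst x + fst y - j, snd x * snd y) (lin (sh u v) (sh [(j, 1)])) w)"
  have s: "?s j \<in> fvec UNIV" if "j \<in> {1..<fst x + fst y}" for j
    using that by (intro fvec_scale pre lin)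
  have eq: "pair (?s j) \<phi> = \<iota> (Dc j (fst x) (fst y)) *
      pair (sh u v) (\<lambda>b. pair (sh [(j, 1)] b) (\<lambda>w. \<phi> ((fst x + fst y - j, snd x * snd y) # w)))"
    if "j \<in> {1..<fst x + fst y}" for j
    using that by (simp add: pair_scale pair_prepend[OF lin] pair_lin[OF sh1])
  have "pair (sh (x # u) (y # v)) \<phi> = pair (prepend x (sh u (y # v))) \<phi> + pair (prepend y (sh (x # u) v)) \<phi>
    + pair (prepend (fst x + fst y, snd x * snd y) (sh u v)) \<phi> + (\<Sum>j\<in>{1..<fst x + fst y}. pair (?s j) \<phi>)"
    unfolding sh_Cons by (rule pair_add4) (intro pre sh | erule s)+
  then show ?thesis
    by (simp only: eq pair_prepend[OF sh(1)] pair_prepend[OF sh(2)] pair_prepend[OF sh(3)] cong: sum.cong)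
qed

text \<open>Induction on the flag, with u and v arbitrary. In the product of the two values, a
  letter on the top level comes from u, from v, or from both. The first two cases match the first
  two summands of the shuffle recursion. In the third, \<open>psum_product\<close> expands two power
  sums of the same level into the remaining summands.\<close>

theorem ev_sh:
  "u \<in> valid_words \<Longrightarrow> v \<in> valid_words \<Longrightarrow> pair (sh u v) (ev ys) = ev ys u * ev ys v"
proof (induction ys arbitrary: u v)
  case Nil
  show ?case
  proof (cases "u = [] \<or> v = []")
    case False
    then have "wt u > 0" "wt v > 0" using Nil wt_eq_0_iff by blast+
    moreover have "b \<noteq> []" if "sh u v b \<noteq> 0" for b
      using sh_support[OF that Nil] \<open>wt u > 0\<close> by auto
    ultimately show ?thesis using False by (auto intro!: pair_zero_right)
  qed auto
next
  case (Cons z ys)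
  consider "u = []" | "v = []" | x u' y v' where "u = x # u'" "v = y # v'"
    by (meson neq_Nil_conv)
  then show ?case
  proof cases
    case 3
    let ?H = "\<lambda>n. psum (fst z) ys $ (n - 1)"
    obtain a \<alpha> b \<beta> where x: "x = (a, \<alpha>)" and y: "y = (b, \<beta>)" by fastforce
    have valid: "(a, \<alpha>) # u' \<in> valid_words" "(b, \<beta>) # v' \<in> valid_words" "u' \<in> valid_words" "v' \<in> valid_words"
      and ab: "a \<ge> 1" "b \<ge> 1"
      using Cons.prems by (auto simp: 3 x y)
    \<comment> \<open>The product with x_j is evaluated on the lower levels only, so the induction
      hypothesis applies twice.\<close>
    have "pair (sh u' v') (\<lambda>w. pair (sh [(j, 1)] w) (ev ys)) = ev ys [(j, 1)] * (ev ys u' * ev ys v')"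
      if "j \<in> {1..<a + b}" for j
    proof -
      have "pair (sh u' v') (\<lambda>w. pair (sh [(j, 1)] w) (ev ys)) = pair (sh u' v') (\<lambda>w. ev ys [(j, 1)] * ev ys w)"
        by (rule pair_fvec_cong[OF sh_fvec_valid]) (use valid that in \<open>auto intro!: Cons.IH\<close>)
      then show ?thesis using valid by (simp add: pair_const_mult Cons.IH)
    qed
    then have "pair (sh u v) (top_ev z ys (ev ys)) = \<iota> \<alpha> ^ snd z * ?H a * (ev ys u' * ev ys v)
        + \<iota> \<beta> ^ snd z * ?H b * (ev ys u * ev ys v')
        + \<iota> (\<alpha> * \<beta>) ^ snd z * (?H (a + b)
          + (\<Sum>j\<in>{1..<a + b}. \<iota> (Dc j a b) * (?H (a + b - j) * ev ys [(j, 1)]))) * (ev ys u' * ev ys v')"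
      using valid
      by (simp add: 3 x y pair_sh_Cons pair_const_mult Cons.IH del: valid_words_simps cong: sum.cong)
         (simp add: sum_distrib_left sum_distrib_right distrib_left distrib_right mult_ac)
    also have "\<dots> = top_ev z ys (ev ys) u * ev ys v + ev ys u * top_ev z ys (ev ys) v
        + top_ev z ys (ev ys) u * top_ev z ys (ev ys) v"
      unfolding psum_product[OF ab, symmetric] 3 x y top_ev_simps fst_conv snd_conv \<iota>_mult power_mult_distrib
      by (simp only: mult_ac)
    finally have top: "pair (sh u v) (top_ev z ys (ev ys)) = \<dots>" .
    have ev: "ev (z # ys) = (\<lambda>w. ev ys w + top_ev z ys (ev ys) w)" by (rule ext) simp
    show ?thesis
      unfolding ev pair_add_right Cons.IH[OF Cons.prems] top by (simp only: distrib_left distrib_right add_ac)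
  qed simp_all
qed

lemma ev_shuffle_mult:
  assumes "F \<in> fvec valid_words" "G \<in> fvec valid_words"
  shows "pair (shuffle_mult F G) (ev ys) = pair F (ev ys) * pair G (ev ys)"
proof -
  have "pair (lin G (sh u)) (ev ys) = ev ys u * pair G (ev ys)" if "u \<in> valid_words" for u
  proof -
    have "pair (lin G (sh u)) (ev ys) = pair G (\<lambda>v. pair (sh u v) (ev ys))"
      by (rule pair_lin[of _ _ valid_words]) (use assms that in \<open>auto dest: fvecD\<close>)
    also have "\<dots> = pair G (\<lambda>v. ev ys u * ev ys v)"
      by (rule pair_fvec_cong[OF assms(2)]) (rule ev_sh[OF that])
    finally show ?thesis by (simp add: pair_const_mult)
  qed
  moreover have "pair (shuffle_mult F G) (ev ys) = pair F (\<lambda>u. pair (lin G (sh u)) (ev ys))"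
    unfolding shuffle_mult_lin
    by (rule pair_lin[of _ _ valid_words], intro fvec_lin sh_fvec_valid) (use assms in \<open>auto dest: fvecD\<close>)
  moreover have "pair F (\<lambda>u. pair (lin G (sh u)) (ev ys)) = pair F (\<lambda>u. ev ys u * pair G (ev ys))"
    by (rule pair_fvec_cong[OF assms(1)]) (rule calculation)
  ultimately have "pair (shuffle_mult F G) (ev ys) = pair F (\<lambda>u. ev ys u * pair G (ev ys))"
    by (simp only:)
  then show ?thesis by (simp add: pair_mult_const)
qed

section \<open>The coproduct as concatenation of flags\<close>

text \<open>Multiplicativity of \<open>ev\<close> reduces the iterated shuffle to values of single
  letters, and the factors \<open>Dc\<close> select those with weight divisible by q - 1.\<close>

lemma ev_bracket:
  assumes "a \<in> ones n"
  shows "pair (bracket a) (ev ys) = (- 1) ^ length a * (\<Prod>l\<leftarrow>a. iexf ys $ fst l)"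
proof -
  have a: "a \<in> valid_words" "wt a = n" using assms ones_subset by auto
  let ?f = "\<lambda>b. foldr (\<lambda>l. shuffle_mult (delta [l])) b (delta [])"
  have "?f b \<in> fvec valid_words \<and> pair (?f b) (ev ys) = (\<Prod>l\<leftarrow>b. ev ys [l])" if "b \<in> valid_words" for b
    using that
  proof (induction b)
    case (Cons l b)
    then have l: "(delta [l] :: 'a word \<Rightarrow> 'a) \<in> fvec valid_words" and b: "?f b \<in> fvec valid_words"
      "pair (?f b) (ev ys) = (\<Prod>l\<leftarrow>b. ev ys [l])"
      by auto
    show ?case
      using shuffle_mult_fvec_valid[OF l b(1)] ev_shuffle_mult[OF l b(1), of ys] b(2) by simp
  qed simp
  then have f: "pair (?f a) (ev ys) = (\<Prod>l\<leftarrow>a. ev ys [l])" using a(1) by blast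
  have \<iota>_prod: "\<iota> (\<Prod>l\<leftarrow>b. f l) = (\<Prod>l\<leftarrow>b. \<iota> (f l))" for b :: "'a word" and f
    by (induction b) (simp_all add: \<iota>_mult)
  have "pair (bracket a) (ev ys)
      = (- 1) ^ length a * ((\<Prod>l\<leftarrow>a. \<iota> (Dc (fst l) 1 (wt a + 1))) * (\<Prod>l\<leftarrow>a. ev ys [l]))"
    unfolding bracket_def pair_scale f \<iota>_mult \<iota>_prod by (simp only: \<iota>_power \<iota>_uminus \<iota>_1 mult.assoc)
  also have "(\<Prod>l\<leftarrow>a. \<iota> (Dc (fst l) 1 (wt a + 1))) * (\<Prod>l\<leftarrow>a. ev ys [l])
      = (\<Prod>l\<leftarrow>a. \<iota> (Dc (fst l) 1 (wt a + 1)) * ev ys [l])"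
  proof -
    have "(\<Prod>l\<leftarrow>b. f l) * (\<Prod>l\<leftarrow>b. g l) = (\<Prod>l\<leftarrow>b. f l * g l)" for b :: "'a word" and f g :: "_ \<Rightarrow> 'k"
      by (induction b) (simp_all add: mult_ac)
    then show ?thesis .
  qed
  also have "\<dots> = (\<Prod>l\<leftarrow>a. iexf ys $ fst l)"
  proof (intro arg_cong[of _ _ prod_list] map_cong refl)
    fix l assume l: "l \<in> set a"
    then have "fst l \<ge> 1" "snd l = 1" "fst l \<le> wt a"
      using assms letter_le_wt[OF l] by (auto simp: ones_def)
    \<comment> \<open>For a letter of weight i, the bound i - 1 < \<open>wt a\<close> kills the
      second binomial of \<open>Dc i 1 (wt a + 1)\<close> and the first is 1. So \<open>Dc\<close>
      is the indicator that q - 1 divides i, as in \<open>iexf\<close>.\<close>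
    then have "l = (fst l, 1)" "fst l - 1 < wt a" "fst l \<noteq> 0" by (auto simp: prod_eq_iff)
    then show "\<iota> (Dc (fst l) 1 (wt a + 1)) * ev ys [l] = iexf ys $ fst l"
      unfolding Dc_def iexf_def fps_nth_Abs_fps q_eq[symmetric] by (subst \<open>l = (fst l, 1)\<close>) (simp add: binomial_eq_0)
  qed
  finally show ?thesis .
qed

text \<open>The binomial series \<open>(1 + Z)\<^bsup>-r\<^esup>\<close> with \<open>Z = iexf ys - 1\<close>, expanded over words.\<close>
definition inv_series :: "'k flag \<Rightarrow> nat \<Rightarrow> 'k fps" where
  "inv_series ys r = Abs_fps (\<lambda>n. \<Sum>a\<in>(ones n :: 'a word set). of_nat ((r + length a - 1) choose length a) *
     ((- 1) ^ length a * (\<Prod>l\<leftarrow>a. iexf ys $ fst l)))"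

lemma ones_0: "ones 0 = {[] :: 'a word}"
proof -
  have "w = []" if "w \<in> ones 0" for w :: "'a word"
    using that by (cases w) (auto simp: ones_def)
  then show ?thesis by (auto simp: ones_def)
qed

lemma ones_Suc: "(ones (Suc n) :: 'a word set) = (\<Union>j\<in>{1..Suc n}. (#) (j, 1) ` ones (Suc n - j))"
proof
  show "(ones (Suc n) :: 'a word set) \<subseteq> (\<Union>j\<in>{1..Suc n}. (#) (j, 1) ` ones (Suc n - j))"
  proof
    fix w :: "'a word" assume w: "w \<in> ones (Suc n)"
    then obtain x v where "w = x # v" by (cases w) (auto simp: ones_def)
    with w have "fst x \<in> {1..Suc n}" "w = (fst x, 1) # v" "v \<in> ones (Suc n - fst x)"
      by (auto simp: ones_def prod_eq_iff)
    then show "w \<in> (\<Union>j\<in>{1..Suc n}. (#) (j, 1) ` ones (Suc n - j))" by blast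
  qed
qed (auto simp: ones_def)

lemma sum_ones_Suc:
  "(\<Sum>w\<in>(ones (Suc n) :: 'a word set). f w) = (\<Sum>j\<in>{1..Suc n}. \<Sum>v\<in>ones (Suc n - j). f ((j, 1) # v))"
proof -
  have "(\<Sum>w\<in>ones (Suc n). f w) = (\<Sum>j\<in>{1..Suc n}. \<Sum>w\<in>(#) (j, 1) ` ones (Suc n - j). f w)"
    unfolding ones_Suc by (rule sum.UNION_disjoint) (auto simp: finite_ones)
  then show ?thesis by (simp add: sum.reindex)
qed

lemma inv_series_0: "inv_series ys 0 = 1"
proof (rule fps_ext)
  fix n
  show "inv_series ys 0 $ n = (1 :: 'k fps) $ n"
  proof (cases n)
    case (Suc m)
    have "of_nat ((0 + length a - 1) choose length a) = (0 :: 'k)" if "a \<in> ones (Suc m)" for a :: "'a word"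
      using that by (cases a) (auto simp: ones_def binomial_eq_0)
    then show ?thesis by (simp add: Suc inv_series_def)
  qed (simp add: inv_series_def ones_0)
qed

text \<open>Multiplying by a nonconstant term of \<open>iexf\<close> prepends a letter to a word and
  flips the sign; Pascal's rule merges the two binomials.\<close>

lemma inv_series_Suc: "inv_series ys (Suc r) * iexf ys = inv_series ys r"
proof (rule fps_ext)
  fix n
  let ?P = "\<lambda>a. (- 1) ^ length a * (\<Prod>l\<leftarrow>a. iexf ys $ fst l)"
  have i0: "iexf ys $ 0 = 1" by (simp add: iexf_def)
  show "(inv_series ys (Suc r) * iexf ys) $ n = inv_series ys r $ n"
  proof (cases n)
    case (Suc m)
    have "(\<Sum>j\<in>{1..Suc m}. iexf ys $ j * inv_series ys (Suc r) $ (Suc m - j))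
      = (\<Sum>j\<in>{1..Suc m}. \<Sum>v\<in>(ones (Suc m - j) :: 'a word set). (\<lambda>a. - of_nat ((r + length a - 1) choose (length a - 1)) * ?P a) ((j, 1) # v))"
      unfolding inv_series_def fps_nth_Abs_fps sum_distrib_left
      by (intro sum.cong refl) (simp add: mult_ac)
    also have "\<dots> = (\<Sum>a\<in>(ones (Suc m) :: 'a word set). - of_nat ((r + length a - 1) choose (length a - 1)) * ?P a)"
      by (rule sum_ones_Suc[symmetric])
    finally have tail: "(\<Sum>j\<in>{1..Suc m}. iexf ys $ j * inv_series ys (Suc r) $ (Suc m - j)) = \<dots>" .
    have "(iexf ys * inv_series ys (Suc r)) $ Suc m = inv_series ys (Suc r) $ Suc m
      + (\<Sum>a\<in>(ones (Suc m) :: 'a word set). - of_nat ((r + length a - 1) choose (length a - 1)) * ?P a)"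
      unfolding fps_mult_nth tail[symmetric] by (subst sum.atLeast_Suc_atMost) (simp_all only: i0 mult_1 diff_zero One_nat_def)
    also have "\<dots> = (\<Sum>a\<in>(ones (Suc m) :: 'a word set). of_nat ((r + length a - 1) choose length a) * ?P a)"
      unfolding inv_series_def fps_nth_Abs_fps sum.distrib[symmetric]
    proof (rule sum.cong)
      fix a :: "'a word" assume "a \<in> ones (Suc m)"
      then obtain l b where a: "a = l # b" by (cases a) (auto simp: ones_def)
      show "of_nat ((Suc r + length a - 1) choose length a) * ?P a
          + - of_nat ((r + length a - 1) choose (length a - 1)) * ?P a
        = of_nat ((r + length a - 1) choose length a) * ?P a"
        by (simp only: distrib_right[symmetric]) (simp add: a)
    qed simp
    finally show ?thesis
      unfolding Suc mult.commute[of "inv_series ys (Suc r)"] by (simp only: inv_series_def[of ys r] fps_nth_Abs_fps)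
  qed (simp add: inv_series_def ones_0 i0)
qed

lemma inv_series_exf: "fps_X ^ r * inv_series ys r = exf ys ^ r"
proof (induction r)
  case (Suc r)
  have "fps_X ^ Suc r * inv_series ys (Suc r) = fps_X ^ r * (inv_series ys (Suc r) * iexf ys) * exf ys"
    by (simp only: power_Suc2 iexf_exf[of ys, symmetric] mult_ac)
  then show ?case by (simp only: inv_series_Suc Suc.IH power_Suc2)
qed (simp add: inv_series_0)

text \<open>Summed over words, the brackets give \<open>inv_series ys (r - 1)\<close>, that is (e /
  X)^(r-1), so powers of e appear. The binomial has r + depth - 2 = (r - 1) + depth - 1 on top;
  truncated subtraction matters only for r = 1 and the empty word, where the value is 1 either
  way.\<close>

lemma copL_ev:
  assumes "fst x \<ge> 1" "snd x \<noteq> 0"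
  shows "pair (copL x) (\<lambda>p. f (fst p) * ev ys (snd p))
    = (\<Sum>r\<in>{1..fst x}. f [(r, snd x)] * (exf ys ^ (r - 1)) $ (fst x - 1))"
proof -
  have t: "tensor (delta [(r, snd x)]) (bracket a) \<in> fvec UNIV"
    and b: "bracket a \<in> fvec valid_words" if "a \<in> ones (fst x - r)" for r a
  proof -
    show b: "bracket a \<in> fvec valid_words"
      using that ones_subset[of "fst x - r"] by (intro fvec_mono[OF bracket_in_fvec]) auto
    show "tensor (delta [(r, snd x)]) (bracket a) \<in> fvec UNIV"
      by (rule fvec_mono[OF fvec_tensor[OF _ b, of _ UNIV]]) auto
  qed
  have "pair (copL x) (\<lambda>p. f (fst p) * ev ys (snd p)) =
    (\<Sum>r\<in>{1..fst x}. \<Sum>a\<in>ones (fst x - r). of_nat ((r + length a - 2) choose length a) *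
       (f [(r, snd x)] * pair (bracket a) (ev ys)))"
    unfolding copL_lin
    apply (subst pair_sum[of _ _ UNIV])
     apply (intro fvec_sum fvec_scale t, assumption)
    apply (intro sum.cong refl)
    apply (subst pair_sum[of _ _ UNIV])
     apply (intro fvec_scale t, assumption)
    apply (intro sum.cong refl)
    apply (subst pair_scale, subst pair_tensor[OF _ b, of _ UNIV])
      apply (simp_all add: \<iota>_of_nat)
    done
  also have "\<dots> = (\<Sum>r\<in>{1..fst x}. f [(r, snd x)] * inv_series ys (r - 1) $ (fst x - r))"
    by (intro sum.cong refl) (auto simp: inv_series_def sum_distrib_left ev_bracket mult_ac numeral_2_eq_2
        intro!: sum.cong)
  \<comment> \<open>The factor X^(r-1) moves the coefficient from n - r to n - 1, where n is the
    weight of x.\<close>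
  also have "\<dots> = (\<Sum>r\<in>{1..fst x}. f [(r, snd x)] * (exf ys ^ (r - 1)) $ (fst x - 1))"
    by (intro sum.cong refl)
       (auto simp flip: inv_series_exf simp: fps_X_power_mult_nth)
  finally show ?thesis .
qed

lemma pair_concat_sh:
  assumes "snd p \<in> valid_words" "snd p' \<in> valid_words"
  shows "pair (concat_sh p p') (\<lambda>p. f (fst p) * ev ys (snd p))
    = f (fst p @ fst p') * (ev ys (snd p) * ev ys (snd p'))"
  unfolding concat_sh_def using assms
  by (subst pair_tensor[of _ UNIV _ valid_words]) (auto simp: ev_sh)

text \<open>The functional on left factors is arbitrary because \<open>ev_cop\<close> inserts
  \<open>top_ev\<close>, which looks at the first letter of the concatenated word.\<close>

lemma pair_cop_Cons:
  assumes "x # v \<in> valid_words"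
  shows "pair (cop (x # v)) (\<lambda>p. f (fst p) * ev ys (snd p)) = f [] * ev ys (x # v)
    + pair (copL x) (\<lambda>p. pair (cop v) (\<lambda>p'. f (fst p @ fst p') * ev ys (snd p')) * ev ys (snd p))"
proof -
  have x: "fst x \<ge> 1" "snd x \<noteq> 0" "v \<in> valid_words" using assms by auto
  have valid: "snd p \<in> valid_words" "snd p' \<in> valid_words" "concat_sh p p' \<in> fvec UNIV"
    if "copL x p \<noteq> 0" "cop v p' \<noteq> 0" for p p'
  proof -
    show "snd p \<in> valid_words" "snd p' \<in> valid_words"
      using that copL_in_fvec(2)[OF x(2)] cop_in_fvec[OF x(3)] by (auto dest: fvecD)
    then show "concat_sh p p' \<in> fvec UNIV"
      unfolding concat_sh_def by (intro fvec_mono[OF fvec_tensor[of _ UNIV _ valid_words]]) auto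
  qed
  have "pair (lin (copL x) (\<lambda>p. lin (cop v) (concat_sh p))) (\<lambda>p. f (fst p) * ev ys (snd p))
    = pair (copL x) (\<lambda>p. pair (cop v) (\<lambda>p'. f (fst p @ fst p') * (ev ys (snd p) * ev ys (snd p'))))"
    apply (subst pair_lin[of _ _ UNIV])
     apply (intro fvec_lin valid; assumption)
    apply (intro pair_cong)
    apply (subst pair_lin[of _ _ UNIV])
     apply (intro valid; assumption)
    apply (intro pair_cong pair_concat_sh valid; assumption)
    done
  also have "\<dots> = pair (copL x) (\<lambda>p. pair (cop v) (\<lambda>p'. f (fst p @ fst p') * ev ys (snd p')) * ev ys (snd p))"
    by (rule arg_cong[of _ _ "pair (copL x)"], rule ext, subst pair_mult_const[symmetric]) (simp only: mult_ac)
  finally show ?thesis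
    unfolding cop_Cons using valid
    by (subst pair_add[of _ UNIV _ UNIV]) (auto intro!: fvec_lin)
qed

text \<open>Induction on the upper flag. The increment from a new top level involves the power sum
  of the first letter only: \<open>copL_ev\<close> expands it in powers of \<open>exf ys\<close>,
  which by \<open>psum_append\<close> reassemble into the power sum over \<open>zs @ ys\<close>; the
  tail is covered by the induction hypothesis. Without upper levels, \<open>ev []\<close> kills
  every nonempty left factor.\<close>

theorem ev_cop:
  "w \<in> valid_words \<Longrightarrow> pair (cop w) (\<lambda>p. ev zs (fst p) * ev ys (snd p)) = ev (zs @ ys) w"
proof (induction zs arbitrary: w)
  case Nil
  show ?case
  proof (cases w)
    case (Cons x v)
    with Nil have v: "x # v \<in> valid_words" "snd x \<noteq> 0" by auto
    have "fst p \<noteq> []" if "copL x p \<noteq> 0" for p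
      using fvecD[OF copL_in_fvec(1)[OF v(2)] that] by auto
    then show ?thesis
      unfolding Cons pair_cop_Cons[OF v(1)] by (auto intro!: pair_zero_right)
  qed simp
next
  case (Cons z zs)
  show ?case
  proof (cases w)
    case Nil
    then show ?thesis by simp
  next
    case w: (Cons x v)
    with Cons.prems have xv: "x # v \<in> valid_words" and x: "fst x \<ge> 1" "snd x \<noteq> 0" and v: "v \<in> valid_words"
      by auto
    let ?c = "\<iota> (snd x) ^ snd z" and ?t = "top_ev z zs (ev zs)"
    let ?g = "\<lambda>u. pair (cop v) (\<lambda>p'. ?t (u @ fst p') * ev ys (snd p'))"
    have g: "?g [(r, snd x)] = ?c * psum (fst z) zs $ (r - 1) * ev (zs @ ys) v" for r
    proof -
      have "?g [(r, snd x)] = pair (cop v) (\<lambda>p'. (?c * psum (fst z) zs $ (r - 1)) * (ev zs (fst p') * ev ys (snd p')))"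
        by (simp add: mult_ac)
      then show ?thesis by (simp only: pair_const_mult Cons.IH[OF v])
    qed
    have "pair (cop w) (\<lambda>p. ?t (fst p) * ev ys (snd p))
      = (\<Sum>r\<in>{1..fst x}. ?g [(r, snd x)] * (exf ys ^ (r - 1)) $ (fst x - 1))"
      unfolding w pair_cop_Cons[OF xv] copL_ev[OF x, of ?g] by simp
    also have "\<dots> = ?c * (\<Sum>r\<in>{1..fst x}. psum (fst z) zs $ (r - 1) * (exf ys ^ (r - 1)) $ (fst x - 1)) * ev (zs @ ys) v"
      unfolding g by (simp add: sum_distrib_left sum_distrib_right mult_ac)
    also have "(\<Sum>r\<in>{1..fst x}. psum (fst z) zs $ (r - 1) * (exf ys ^ (r - 1)) $ (fst x - 1))
      = psum (fst z) (zs @ ys) $ (fst x - 1)"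
      unfolding psum_append fps_compose_nth
      by (rule sum.reindex_bij_witness[of _ Suc "\<lambda>r. r - 1"]) (use x in auto)
    finally have "pair (cop w) (\<lambda>p. ?t (fst p) * ev ys (snd p)) = top_ev z (zs @ ys) (ev (zs @ ys)) w"
      by (simp add: w)
    then show ?thesis
      using Cons.IH[OF Cons.prems] by (simp add: distrib_right pair_add_right)
  qed
qed

end

section \<open>Convolution powers behind the antipode, and threefold tensors\<close>

definition antipode_step :: "'a::{field,finite} word \<Rightarrow> 'a word \<Rightarrow> 'a" where
  "antipode_step v = (if v = [] then (\<lambda>x. 0) else (\<lambda>x. - delta v x))"

primrec antipode_pow :: "nat \<Rightarrow> 'a::{field,finite} word \<Rightarrow> 'a word \<Rightarrow> 'a" where
  "antipode_pow 0 w = (if w = [] then delta [] else (\<lambda>x. 0))"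
| "antipode_pow (Suc k) w = lin (cop w) (\<lambda>p. shuffle_mult (antipode_pow k (fst p)) (antipode_step (snd p)))"

text \<open>The geometric series of the convolution powers of \<open>u \<epsilon> - id\<close>, which vanish on words of
  smaller weight than the exponent.\<close>
definition antipode :: "('a::{field,finite} word \<Rightarrow> 'a) \<Rightarrow> 'a word \<Rightarrow> 'a" where
  "antipode F = lin F (\<lambda>w x. \<Sum>k\<le>wt w. antipode_pow k w x)"

lemma antipode_step_fvec: "v \<in> valid_words \<Longrightarrow> antipode_step v \<in> fvec valid_words"
  by (auto simp: antipode_step_def intro!: fvec_uminus)

lemma antipode_pow_fvec: "w \<in> valid_words \<Longrightarrow> antipode_pow k w \<in> fvec valid_words"
proof (induction k arbitrary: w)
  case (Suc k)
  have "fst p \<in> valid_words" "snd p \<in> valid_words" if "cop w p \<noteq> 0" for p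
    using fvecD[OF cop_in_fvec[OF Suc.prems] that] by auto
  then show ?case
    unfolding antipode_pow.simps by (intro fvec_lin shuffle_mult_fvec_valid Suc.IH antipode_step_fvec)
qed simp

lemma antipode_delta: "antipode (delta w) = (\<lambda>x. \<Sum>k\<le>wt w. antipode_pow k w x)"
  by (simp add: antipode_def)

lemma antipode_delta_fvec: "w \<in> valid_words \<Longrightarrow> antipode (delta w) \<in> fvec valid_words"
  unfolding antipode_delta by (intro fvec_sum antipode_pow_fvec)

lemma antipode_lin: "antipode F = lin F (\<lambda>w. antipode (delta w))"
  by (simp add: antipode_def)

lemma antipode_fvec: "F \<in> fvec valid_words \<Longrightarrow> antipode F \<in> fvec valid_words"
  unfolding antipode_lin[of F] by (intro fvec_lin antipode_delta_fvec) (auto dest: fvecD)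

text \<open>Applying the coproduct to a left factor produces left-nested pairs; both sides of
  coassociativity must live on the same basis.\<close>

definition reassoc :: "(('b \<times> 'c) \<times> 'd \<Rightarrow> 'a) \<Rightarrow> 'b \<times> 'c \<times> 'd \<Rightarrow> 'a" where
  "reassoc T = (\<lambda>t. T ((fst t, fst (snd t)), snd (snd t)))"

lemma fvec_reassoc:
  assumes "T \<in> fvec ((B \<times> C) \<times> D)"
  shows "reassoc T \<in> fvec (B \<times> C \<times> D)"
proof (rule fvecI)
  let ?h = "\<lambda>t. (fst (fst t), snd (fst t), snd t)"
  show "finite (?h ` supp T)" "?h ` supp T \<subseteq> B \<times> C \<times> D"
    using assms by (fastforce simp: fvec_def)+
  fix t assume "reassoc T t \<noteq> 0"
  then show "t \<in> ?h ` supp T"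
    by (intro image_eqI[of _ _ "((fst t, fst (snd t)), snd (snd t))"]) (auto simp: reassoc_def supp_def)
qed

context flag_model
begin

section \<open>Linear independence of the evaluations\<close>

text \<open>The coefficients range over the large field, not F_q: in \<open>separating_prod\<close>
  the inner sums, which are values of functionals, become coefficients.\<close>

definition separating :: "'b set \<Rightarrow> ('b \<Rightarrow> 'k) set \<Rightarrow> bool" where
  "separating B \<Phi> \<longleftrightarrow> (\<forall>A c. finite A \<longrightarrow> A \<subseteq> B \<longrightarrow> (\<forall>\<phi>\<in>\<Phi>. (\<Sum>b\<in>A. c b * \<phi> b) = 0) \<longrightarrow> (\<forall>b\<in>A. c b = 0))"

lemma separatingD:
  assumes "separating B \<Phi>" "finite A" "A \<subseteq> B" "\<And>\<phi>. \<phi> \<in> \<Phi> \<Longrightarrow> (\<Sum>b\<in>A. c b * \<phi> b) = 0" "b \<in> A"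
  shows "c b = 0"
  using assms unfolding separating_def by blast

lemma separating_eqI:
  assumes sep: "separating B \<Phi>" and "F \<in> fvec B" "G \<in> fvec B"
    and eq: "\<And>\<phi>. \<phi> \<in> \<Phi> \<Longrightarrow> pair F \<phi> = pair G \<phi>"
  shows "F = G"
proof
  fix x
  let ?A = "supp F \<union> supp G"
  have A: "finite ?A" "?A \<subseteq> B" using assms(2,3) by (auto simp: fvec_def)
  have "(\<Sum>b\<in>?A. (\<iota> (F b) - \<iota> (G b)) * \<phi> b) = 0" if "\<phi> \<in> \<Phi>" for \<phi>
    using eq[OF that] unfolding pair_superset[OF A(1) Un_upper1] pair_superset[OF A(1) Un_upper2]
    by (simp add: left_diff_distrib sum_subtractf)
  from separatingD[OF sep A this] have "\<iota> (F x) - \<iota> (G x) = 0" if "x \<in> ?A"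
    using that by blast
  then show "F x = G x"
    by (cases "x \<in> ?A") (auto simp: \<iota>_eq_iff supp_def)
qed

lemma separating_prod:
  assumes "separating B \<Phi>" "separating C \<Psi>"
  shows "separating (B \<times> C) {\<lambda>p. \<phi> (fst p) * \<psi> (snd p) | \<phi> \<psi>. \<phi> \<in> \<Phi> \<and> \<psi> \<in> \<Psi>}"
  unfolding separating_def
proof (intro allI impI ballI)
  fix A c p
  assume A: "finite A" "A \<subseteq> B \<times> C" and p: "p \<in> A"
    and 0: "\<forall>\<chi>\<in>{\<lambda>p. \<phi> (fst p) * \<psi> (snd p) | \<phi> \<psi>. \<phi> \<in> \<Phi> \<and> \<psi> \<in> \<Psi>}. (\<Sum>b\<in>A. c b * \<chi> b) = 0"
  define d where "d = (\<lambda>b. if b \<in> A then c b else 0)"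
  have sub: "A \<subseteq> fst ` A \<times> snd ` A" by force
  have fin: "finite (fst ` A)" "finite (snd ` A)" using A by auto
  have BC: "fst ` A \<subseteq> B" "snd ` A \<subseteq> C" using A by auto
  have *: "(\<Sum>v\<in>snd ` A. d (u, v) * \<psi> v) = 0" if "\<psi> \<in> \<Psi>" "u \<in> fst ` A" for u \<psi>
  proof (rule separatingD[OF assms(1) fin(1) BC(1) _ that(2)])
    fix \<phi> assume "\<phi> \<in> \<Phi>"
    with that have "(\<lambda>p. \<phi> (fst p) * \<psi> (snd p)) \<in> {\<lambda>p. \<phi> (fst p) * \<psi> (snd p) | \<phi> \<psi>. \<phi> \<in> \<Phi> \<and> \<psi> \<in> \<Psi>}"
      by blast
    from bspec[OF 0 this] have "(\<Sum>b\<in>A. c b * (\<phi> (fst b) * \<psi> (snd b))) = 0" .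
    also have "(\<Sum>b\<in>A. c b * (\<phi> (fst b) * \<psi> (snd b)))
        = (\<Sum>b\<in>fst ` A \<times> snd ` A. d b * (\<phi> (fst b) * \<psi> (snd b)))"
      by (rule sum.mono_neutral_cong_left) (use sub fin in \<open>auto simp: d_def\<close>)
    also have "\<dots> = (\<Sum>u\<in>fst ` A. (\<Sum>v\<in>snd ` A. d (u, v) * \<psi> v) * \<phi> u)"
      unfolding sum_distrib_right sum.cartesian_product by (auto intro!: sum.cong simp: mult_ac split_beta)
    finally show "(\<Sum>u\<in>fst ` A. (\<Sum>v\<in>snd ` A. d (u, v) * \<psi> v) * \<phi> u) = 0" .
  qed
  have "d (fst p, snd p) = 0"
    by (rule separatingD[OF assms(2) fin(2) BC(2), of "\<lambda>v. d (fst p, v)"]) (use * p in auto)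
  then show "c p = 0" using p by (simp add: d_def)
qed

text \<open>As a polynomial in y, \<open>psum y ys $ (n - 1)\<close> has degree n and leading
  coefficient 1, so the largest index with nonzero coefficient cannot cancel. Index 0 is excluded
  because 0 - 1 = 1 - 1 in the natural numbers would repeat a polynomial.\<close>

lemma psum_independent:
  assumes "finite M" "0 \<notin> M" "\<And>y. (\<Sum>n\<in>M. h n * psum y ys $ (n - 1)) = 0" "n \<in> M"
  shows "h n = 0"
proof (rule ccontr)
  assume n: "h n \<noteq> 0"
  define P where "P = (\<lambda>n. \<Sum>k\<le>n. monom ((exf ys ^ k) $ n) (Suc k))"
  have P: "poly (P n) y = psum y ys $ n" for n y
    by (simp add: P_def poly_sum poly_monom psum_nth mult.commute)
  have coeff_P: "coeff (P n) i = (if 0 < i \<and> i \<le> Suc n then (exf ys ^ (i - 1)) $ n else 0)" for n i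
    by (cases i) (auto simp: P_def coeff_sum)
  have "(\<Sum>n\<in>M. smult (h n) (P (n - 1))) = 0"
    by (rule poly_eqI_infinite) (simp only: poly_sum poly_smult P assms(3) poly_0)
  then have 0: "(\<Sum>n\<in>M. h n * coeff (P (n - 1)) i) = 0" for i
    by (metis (no_types, lifting) coeff_0 coeff_smult coeff_sum sum.cong)
  let ?m = "Max {n \<in> M. h n \<noteq> 0}"
  have "finite {n \<in> M. h n \<noteq> 0}" "{n \<in> M. h n \<noteq> 0} \<noteq> {}" using assms n by auto
  then have m: "?m \<in> M" "h ?m \<noteq> 0" and max: "\<And>i. i \<in> M \<Longrightarrow> h i \<noteq> 0 \<Longrightarrow> i \<le> ?m"
    using Max_in[of "{n \<in> M. h n \<noteq> 0}"] Max_ge[of "{n \<in> M. h n \<noteq> 0}"] by blast+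
  have "?m \<noteq> 0" using m assms(2) by metis
  have "h i * coeff (P (i - 1)) ?m = 0" if "i \<in> M - {?m}" for i
  proof (cases "h i = 0")
    case False
    with that max[of i] have "i < ?m" by auto
    moreover have "i \<noteq> 0" using that assms(2) by (metis DiffD1)
    ultimately show ?thesis by (simp add: coeff_P)
  qed simp
  then have "(\<Sum>n\<in>M. h n * coeff (P (n - 1)) ?m) = h ?m * coeff (P (?m - 1)) ?m"
    using sum.mono_neutral_right[of M "{?m}" "\<lambda>n. h n * coeff (P (n - 1)) ?m"] m assms(1) by auto
  also have "coeff (P (?m - 1)) ?m = 1"
    using \<open>?m \<noteq> 0\<close> by (simp add: coeff_P exf_power_nth_diag)
  finally show False using 0[of ?m] m by simp
qed

lemma character_independent:
  assumes "finite E" "\<And>k. (\<Sum>e\<in>E. g e * \<iota> e ^ k) = 0" "e \<in> E"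
  shows "g e = 0"
proof -
  \<comment> \<open>This polynomial vanishes at the images of all elements of E except e; its
    expansion in powers brings in the hypothesis for every k.\<close>
  let ?P = "\<Prod>d\<in>E - {e}. [:- \<iota> d, 1:]"
  have "(\<Sum>d\<in>E. g d * poly ?P (\<iota> d)) = (\<Sum>d\<in>E. \<Sum>i\<le>degree ?P. coeff ?P i * (g d * \<iota> d ^ i))"
    by (simp add: poly_altdef sum_distrib_left mult_ac)
  also have "\<dots> = 0"
    by (subst sum.swap) (simp add: sum_distrib_left[symmetric] assms(2))
  also have "(\<Sum>d\<in>E. g d * poly ?P (\<iota> d)) = (\<Sum>d\<in>{e}. g d * poly ?P (\<iota> d))"
    by (rule sum.mono_neutral_right) (use assms in \<open>auto simp: poly_prod\<close>)
  finally show ?thesis using assms(1) by (auto simp: poly_prod \<iota>_eq_iff)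
qed

text \<open>Evaluations on \<open>(y, k) # ys\<close> and on \<open>ys\<close> differ by
  \<open>top_ev\<close>, which discards the empty word and strips the first letter. Varying y
  separates weights, varying k separates characters, and the tails are one letter shorter. The empty
  word is then isolated by the flag \<open>[]\<close>.\<close>

lemma ev_independent:
  "finite A \<Longrightarrow> A \<subseteq> valid_words \<Longrightarrow> (\<And>w. w \<in> A \<Longrightarrow> length w \<le> N) \<Longrightarrow>
    (\<And>ys. (\<Sum>w\<in>A. c w * ev ys w) = 0) \<Longrightarrow> w \<in> A \<Longrightarrow> c w = 0"
proof (induction N arbitrary: A c w)
  case 0
  then have "A = {[]}" by auto
  with 0(4)[of "[]"] 0(5) show ?case by simp
next
  case (Suc N)
  \<comment> \<open>Not every combination of a weight, a character and a tail taken from A is a word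
    of A; d fills the gaps with 0.\<close>
  define d where "d = (\<lambda>w. if w \<in> A then c w else 0)"
  let ?M = "(\<lambda>w. fst (hd w)) ` (A - {[]})" and ?E = "(\<lambda>w. snd (hd w)) ` (A - {[]})"
  let ?W = "tl ` (A - {[]})"
  have fin: "finite ?M" "finite ?E" "finite ?W" using Suc.prems(1) by auto
  have valid: "hd w # tl w \<in> valid_words" if "w \<in> A - {[]}" for w
    using that Suc.prems(2) by auto
  have M0: "0 \<notin> ?M" using valid by fastforce
  have W: "?W \<subseteq> valid_words" using valid by fastforce
  have len: "length v \<le> N" if "v \<in> ?W" for v using that Suc.prems(3) by fastforce
  have sub: "A - {[]} \<subseteq> (\<lambda>(n, e, v). (n, e) # v) ` (?M \<times> ?E \<times> ?W)"
  proof
    fix w assume w: "w \<in> A - {[]}"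
    then show "w \<in> (\<lambda>(n, e, v). (n, e) # v) ` (?M \<times> ?E \<times> ?W)"
      by (intro image_eqI[of _ _ "(fst (hd w), snd (hd w), tl w)"]) auto
  qed
  have zero: "(\<Sum>v\<in>?W. d ((n, e) # v) * ev ys v) = 0" if n: "n \<in> ?M" and e: "e \<in> ?E" for n e ys
  proof -
    let ?g = "\<lambda>n e. \<Sum>v\<in>?W. d ((n, e) # v) * ev ys v"
    have "(\<Sum>n\<in>?M. (\<Sum>e\<in>?E. ?g n e * \<iota> e ^ k) * psum y ys $ (n - 1)) = 0" for y k
    proof -
      let ?t = "top_ev (y, k) ys (ev ys)"
      have "(\<Sum>w\<in>A. c w * ?t w) = 0"
        using Suc.prems(4)[of ys] Suc.prems(4)[of "(y, k) # ys"] by (simp add: distrib_left sum.distrib)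
      also have "(\<Sum>w\<in>A. c w * ?t w) = (\<Sum>w\<in>A - {[]}. c w * ?t w)"
        by (rule sum.mono_neutral_right) (use Suc.prems(1) in auto)
      also have "\<dots> = (\<Sum>w\<in>(\<lambda>(n, e, v). (n, e) # v) ` (?M \<times> ?E \<times> ?W). d w * ?t w)"
        by (rule sum.mono_neutral_cong_left) (use sub fin in \<open>auto simp: d_def\<close>)
      also have "\<dots> = (\<Sum>(n, e, v)\<in>?M \<times> ?E \<times> ?W. d ((n, e) # v) * ?t ((n, e) # v))"
        by (subst sum.reindex) (auto simp: inj_on_def split_beta)
      also have "\<dots> = (\<Sum>n\<in>?M. \<Sum>e\<in>?E. \<Sum>v\<in>?W. d ((n, e) # v) * ?t ((n, e) # v))"
        by (simp only: sum.cartesian_product)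
      also have "\<dots> = (\<Sum>n\<in>?M. (\<Sum>e\<in>?E. ?g n e * \<iota> e ^ k) * psum y ys $ (n - 1))"
        unfolding sum_distrib_right top_ev_simps fst_conv snd_conv by (simp only: mult_ac)
      finally show ?thesis .
    qed
    then have "(\<Sum>e\<in>?E. ?g n e * \<iota> e ^ k) = 0" for k
      by (rule psum_independent[OF fin(1) M0 _ n])
    then show ?thesis by (rule character_independent[OF fin(2) _ e])
  qed
  have nonempty: "c w = 0" if w: "w \<in> A - {[]}" for w
  proof -
    have "d ((fst (hd w), snd (hd w)) # tl w) = 0"
    proof (rule Suc.IH[OF fin(3) W len, of "\<lambda>v. d ((fst (hd w), snd (hd w)) # v)"])
      show "(\<Sum>v\<in>?W. d ((fst (hd w), snd (hd w)) # v) * ev ys v) = 0" for ys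
        by (rule zero) (use w in auto)
    qed (use w in auto)
    then show ?thesis using w by (simp add: d_def)
  qed
  show ?case
  proof (cases "w = []")
    case True
    have "(\<Sum>w\<in>A. c w * ev [] w) = (\<Sum>w\<in>{[]}. c w * ev [] w)"
      by (rule sum.mono_neutral_right) (use Suc.prems True in auto)
    then show ?thesis using Suc.prems(4)[of "[]"] True by simp
  qed (use nonempty Suc.prems(5) in auto)
qed

lemma separating_ev: "separating valid_words (range ev)"
  unfolding separating_def
proof (intro allI impI ballI)
  fix A c w
  assume A: "finite A" "A \<subseteq> (valid_words :: 'a word set)" "w \<in> A"
    and 0: "\<forall>\<phi>\<in>range ev. (\<Sum>b\<in>A. c b * \<phi> b) = 0"
  show "c w = 0"
    by (rule ev_independent[OF A(1,2) _ _ A(3), of "Max (length ` A)"]) (use A 0 in auto)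
qed

lemma eq_by_ev:
  assumes "F \<in> fvec valid_words" "G \<in> fvec valid_words" "\<And>ys. pair F (ev ys) = pair G (ev ys)"
  shows "F = G"
  by (rule separating_eqI[OF separating_ev assms(1,2)]) (use assms(3) in auto)

lemma eq_by_ev2:
  assumes "F \<in> fvec (valid_words \<times> valid_words)" "G \<in> fvec (valid_words \<times> valid_words)"
    and "\<And>zs ys. pair F (\<lambda>p. ev zs (fst p) * ev ys (snd p)) = pair G (\<lambda>p. ev zs (fst p) * ev ys (snd p))"
  shows "F = G"
  by (rule separating_eqI[OF separating_prod[OF separating_ev separating_ev] assms(1,2)]) (use assms(3) in auto)

lemma eq_by_ev3:
  assumes "F \<in> fvec (valid_words \<times> valid_words \<times> valid_words)"
    "G \<in> fvec (valid_words \<times> valid_words \<times> valid_words)"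
    and "\<And>zs ys xs. pair F (\<lambda>p. ev zs (fst p) * (ev ys (fst (snd p)) * ev xs (snd (snd p))))
      = pair G (\<lambda>p. ev zs (fst p) * (ev ys (fst (snd p)) * ev xs (snd (snd p))))"
  shows "F = G"
  by (rule separating_eqI[OF separating_prod[OF separating_ev separating_prod[OF separating_ev separating_ev]] assms(1,2)])
     (use assms(3) in auto)

section \<open>Convolution\<close>

definition conv :: "('a word \<Rightarrow> 'k) \<Rightarrow> ('a word \<Rightarrow> 'k) \<Rightarrow> 'a word \<Rightarrow> 'k" where
  "conv f g = (\<lambda>w. pair (cop w) (\<lambda>p. f (fst p) * g (snd p)))"

lemma pair_Cop:
  assumes "F \<in> fvec valid_words"
  shows "pair (Cop F) \<phi> = pair F (\<lambda>w. pair (cop w) \<phi>)"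
  unfolding Cop_lin by (rule pair_lin[of _ _ "valid_words \<times> valid_words"]) (use assms in \<open>auto dest: fvecD\<close>)

lemma conv_ev: "w \<in> valid_words \<Longrightarrow> conv (ev zs) (ev ys) w = ev (zs @ ys) w"
  by (simp add: conv_def ev_cop)

text \<open>The coproduct preserves weight, so both functionals are tested only on words no heavier
  than w. This permits truncated series in the antipode proof.\<close>

lemma conv_cong:
  assumes "w \<in> valid_words"
    and "\<And>u. u \<in> valid_words \<Longrightarrow> wt u \<le> wt w \<Longrightarrow> f u = f' u"
    and "\<And>u. u \<in> valid_words \<Longrightarrow> wt u \<le> wt w \<Longrightarrow> g u = g' u"
  shows "conv f g w = conv f' g' w"
  unfolding conv_def by (rule pair_fvec_cong[OF cop_in_fvec[OF assms(1)]]) (use assms in auto)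

lemma pair_reassoc: "pair (reassoc T) \<phi> = pair T (\<lambda>t. \<phi> (fst (fst t), snd (fst t), snd t))"
  unfolding pair_def
  by (rule sum.reindex_bij_witness[of _ "\<lambda>t. (fst (fst t), snd (fst t), snd t)"
        "\<lambda>t. ((fst t, fst (snd t)), snd (snd t))"]) (auto simp: supp_def reassoc_def)

definition cop_left :: "('a word \<Rightarrow> 'a) \<Rightarrow> 'a word \<times> 'a word \<times> 'a word \<Rightarrow> 'a" where
  "cop_left F = lin (Cop F) (\<lambda>p. reassoc (tensor (cop (fst p)) (delta (snd p))))"

definition cop_right :: "('a word \<Rightarrow> 'a) \<Rightarrow> 'a word \<times> 'a word \<times> 'a word \<Rightarrow> 'a" where
  "cop_right F = lin (Cop F) (\<lambda>p. tensor (delta (fst p)) (cop (snd p)))"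

context
  fixes F :: "'a word \<Rightarrow> 'a"
  assumes F: "F \<in> fvec valid_words"
begin

lemma Cop_support: "Cop F p \<noteq> 0 \<Longrightarrow> fst p \<in> valid_words \<and> snd p \<in> valid_words"
  using fvecD[OF Cop_fvec_valid[OF F]] by (auto simp: mem_Times_iff)

lemma cop_left_term:
  "Cop F p \<noteq> 0 \<Longrightarrow> reassoc (tensor (cop (fst p)) (delta (snd p))) \<in> fvec (valid_words \<times> valid_words \<times> valid_words)"
  using Cop_support[of p] by (intro fvec_reassoc fvec_tensor cop_fvec_valid) auto

lemma cop_right_term:
  "Cop F p \<noteq> 0 \<Longrightarrow> tensor (delta (fst p)) (cop (snd p)) \<in> fvec (valid_words \<times> valid_words \<times> valid_words)"
  using Cop_support[of p] by (intro fvec_tensor cop_fvec_valid) auto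

lemma pair_cop_left:
  "pair (cop_left F) (\<lambda>p. f (fst p) * (g (fst (snd p)) * h (snd (snd p)))) = pair F (conv (conv f g) h)"
proof -
  have "pair (cop_left F) (\<lambda>p. f (fst p) * (g (fst (snd p)) * h (snd (snd p))))
    = pair (Cop F) (\<lambda>p. pair (tensor (cop (fst p)) (delta (snd p))) (\<lambda>t. (f (fst (fst t)) * g (snd (fst t))) * h (snd t)))"
    unfolding cop_left_def
    by (subst pair_lin[OF cop_left_term], assumption) (simp only: pair_reassoc fst_conv snd_conv mult.assoc)
  also have "\<dots> = pair (Cop F) (\<lambda>p. conv f g (fst p) * h (snd p))"
  proof (rule pair_cong)
    fix p assume "Cop F p \<noteq> 0"
    then have "cop (fst p) \<in> fvec (valid_words \<times> valid_words)" using Cop_support by blast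
    then show "pair (tensor (cop (fst p)) (delta (snd p))) (\<lambda>t. (f (fst (fst t)) * g (snd (fst t))) * h (snd t))
      = conv f g (fst p) * h (snd p)"
      using pair_tensor[of "cop (fst p)" _ "delta (snd p)" UNIV "\<lambda>q. f (fst q) * g (snd q)" h]
      by (simp add: conv_def)
  qed
  finally show ?thesis by (simp add: pair_Cop[OF F] conv_def)
qed

lemma pair_cop_right:
  "pair (cop_right F) (\<lambda>p. f (fst p) * (g (fst (snd p)) * h (snd (snd p)))) = pair F (conv f (conv g h))"
proof -
  have "pair (cop_right F) (\<lambda>p. f (fst p) * (g (fst (snd p)) * h (snd (snd p))))
    = pair (Cop F) (\<lambda>p. pair (tensor (delta (fst p)) (cop (snd p))) (\<lambda>t. f (fst t) * (g (fst (snd t)) * h (snd (snd t)))))"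
    unfolding cop_right_def by (rule pair_lin[OF cop_right_term])
  also have "\<dots> = pair (Cop F) (\<lambda>p. f (fst p) * conv g h (snd p))"
  proof (rule pair_cong)
    fix p assume "Cop F p \<noteq> 0"
    then have "cop (snd p) \<in> fvec (valid_words \<times> valid_words)" using Cop_support by blast
    then show "pair (tensor (delta (fst p)) (cop (snd p))) (\<lambda>t. f (fst t) * (g (fst (snd t)) * h (snd (snd t))))
      = f (fst p) * conv g h (snd p)"
      using pair_tensor[of "delta (fst p)" UNIV "cop (snd p)" _ f "\<lambda>q. g (fst q) * h (snd q)"]
      by (simp add: conv_def)
  qed
  finally show ?thesis by (simp add: pair_Cop[OF F] conv_def)
qed

text \<open>Dual to associativity of \<open>@\<close> on flags, since triple products of evaluations
  separate threefold tensors.\<close>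

lemma coassoc: "cop_left F = cop_right F"
proof (rule eq_by_ev3)
  show "cop_left F \<in> fvec (valid_words \<times> valid_words \<times> valid_words)"
    unfolding cop_left_def by (intro fvec_lin cop_left_term)
  show "cop_right F \<in> fvec (valid_words \<times> valid_words \<times> valid_words)"
    unfolding cop_right_def by (intro fvec_lin cop_right_term)
  fix zs ys xs
  have "conv (conv (ev zs) (ev ys)) (ev xs) w = conv (ev zs) (conv (ev ys) (ev xs)) w"
    if w: "w \<in> valid_words" for w
  proof -
    have "conv (conv (ev zs) (ev ys)) (ev xs) w = conv (ev (zs @ ys)) (ev xs) w"
      by (rule conv_cong[OF w]) (simp_all add: conv_ev)
    also have "\<dots> = conv (ev zs) (ev (ys @ xs)) w" by (simp add: conv_ev[OF w])
    also have "\<dots> = conv (ev zs) (conv (ev ys) (ev xs)) w"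
      by (rule conv_cong[OF w]) (simp_all add: conv_ev)
    finally show ?thesis .
  qed
  then show "pair (cop_left F) (\<lambda>p. ev zs (fst p) * (ev ys (fst (snd p)) * ev xs (snd (snd p))))
      = pair (cop_right F) (\<lambda>p. ev zs (fst p) * (ev ys (fst (snd p)) * ev xs (snd (snd p))))"
    unfolding pair_cop_left pair_cop_right by (rule pair_fvec_cong[OF F])
qed

text \<open>The counit is \<open>ev []\<close>, and the empty flag is neutral for
  \<open>@\<close>.\<close>

lemma counit_left: "lin (Cop F) (\<lambda>p w. counit (delta (fst p)) * delta (snd p) w) = F"
  and counit_right: "lin (Cop F) (\<lambda>p w. counit (delta (snd p)) * delta (fst p) w) = F"
proof -
  have c: "\<iota> (counit (delta u)) = ev [] u" for u :: "'a word"
    by (simp add: counit_def delta_def)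
  have terms: "(\<lambda>w. counit (delta (fst p)) * delta (snd p) w) \<in> fvec valid_words"
    "(\<lambda>w. counit (delta (snd p)) * delta (fst p) w) \<in> fvec valid_words" if "Cop F p \<noteq> 0" for p
    using Cop_support[OF that] by (auto intro!: fvec_scale)
  have "pair (lin (Cop F) (\<lambda>p w. counit (delta (fst p)) * delta (snd p) w)) (ev ys) = pair F (conv (ev []) (ev ys))" for ys
    by (subst pair_lin[OF terms(1)], assumption) (simp add: pair_scale c pair_Cop[OF F] conv_def)
  moreover have "pair (lin (Cop F) (\<lambda>p w. counit (delta (snd p)) * delta (fst p) w)) (ev ys) = pair F (conv (ev ys) (ev []))" for ys
    by (subst pair_lin[OF terms(2)], assumption) (simp add: pair_scale c pair_Cop[OF F] conv_def mult.commute)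
  moreover have "pair F (conv (ev []) (ev ys)) = pair F (ev ys)" "pair F (conv (ev ys) (ev [])) = pair F (ev ys)" for ys
    by (rule pair_fvec_cong[OF F]; simp add: conv_ev)+
  ultimately show "lin (Cop F) (\<lambda>p w. counit (delta (fst p)) * delta (snd p) w) = F"
    "lin (Cop F) (\<lambda>p w. counit (delta (snd p)) * delta (fst p) w) = F"
    by (auto intro!: eq_by_ev fvec_lin terms F)
qed

end

text \<open>The antipode needs this for functionals that are not evaluations, so it is read off the
  tensor identity \<open>coassoc\<close> at a single word.\<close>

lemma conv_assoc: "w \<in> valid_words \<Longrightarrow> conv (conv f g) h w = conv f (conv g h) w"
  using pair_cop_left[of "delta w" f g h] pair_cop_right[of "delta w" f g h] coassoc[of "delta w"] by simp

lemma conv_unit_left: "w \<in> valid_words \<Longrightarrow> conv (ev []) f w = f w"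
  and conv_unit_right: "w \<in> valid_words \<Longrightarrow> conv f (ev []) w = f w"
proof -
  assume w: "w \<in> valid_words"
  have terms: "(\<lambda>w. counit (delta (fst p)) * delta (snd p) w) \<in> fvec UNIV"
    "(\<lambda>w. counit (delta (snd p)) * delta (fst p) w) \<in> fvec UNIV" for p :: "'a word \<times> 'a word"
    by (auto intro!: fvec_scale)
  have c: "\<iota> (counit (delta u)) = ev [] u" for u :: "'a word"
    by (simp add: counit_def delta_def)
  have "conv (ev []) f w = pair (lin (Cop (delta w)) (\<lambda>p w. counit (delta (fst p)) * delta (snd p) w)) f"
    by (subst pair_lin[OF terms(1)]) (simp add: pair_scale c Cop_lin conv_def)
  then show "conv (ev []) f w = f w" using counit_left[of "delta w"] w by simp
  have "conv f (ev []) w = pair (lin (Cop (delta w)) (\<lambda>p w. counit (delta (snd p)) * delta (fst p) w)) f"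
    by (subst pair_lin[OF terms(2)]) (simp add: pair_scale c Cop_lin conv_def mult.commute)
  then show "conv f (ev []) w = f w" using counit_right[of "delta w"] w by simp
qed

lemma conv_diff_right: "conv f (\<lambda>v. g v - h v) w = conv f g w - conv f h w"
  by (simp add: conv_def right_diff_distrib pair_diff_right)

lemma conv_diff_left: "conv (\<lambda>v. g v - h v) f w = conv g f w - conv h f w"
  by (simp add: conv_def left_diff_distrib pair_diff_right)

lemma conv_sum_left: "conv (\<lambda>v. \<Sum>i\<in>A. f i v) g w = (\<Sum>i\<in>A. conv (f i) g w)"
  by (simp add: conv_def sum_distrib_right pair_sum_right)

lemma conv_sum_right: "conv g (\<lambda>v. \<Sum>i\<in>A. f i v) w = (\<Sum>i\<in>A. conv g (f i) w)"
  by (simp add: conv_def sum_distrib_left pair_sum_right)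

section \<open>The antipode\<close>

text \<open>This is \<open>ev ys\<close> composed with u eps - id, that is, the difference of
  \<open>ev []\<close> and \<open>ev ys\<close>.\<close>

definition aug :: "'k flag \<Rightarrow> 'a word \<Rightarrow> 'k" where
  "aug ys v = (if v = [] then 0 else - ev ys v)"

primrec aug_pow :: "'k flag \<Rightarrow> nat \<Rightarrow> 'a word \<Rightarrow> 'k" where
  "aug_pow ys 0 = ev []"
| "aug_pow ys (Suc k) = conv (aug_pow ys k) (aug ys)"

definition ev_inv :: "'k flag \<Rightarrow> 'a word \<Rightarrow> 'k" where
  "ev_inv ys w = (\<Sum>k\<le>wt w. aug_pow ys k w)"

text \<open>Each factor \<open>aug\<close> consumes a nonempty word, hence weight at least
  1.\<close>

lemma aug_pow_eq_0: "w \<in> valid_words \<Longrightarrow> wt w < k \<Longrightarrow> aug_pow ys k w = 0"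
proof (induction k arbitrary: w)
  case (Suc k)
  show ?case
    unfolding aug_pow.simps conv_def
  proof (rule pair_zero_right)
    fix p assume "cop w p \<noteq> 0"
    from fvecD[OF cop_in_fvec[OF Suc.prems(1)] this]
    have p: "fst p \<in> valid_words" "snd p \<in> valid_words" "wt (fst p) + wt (snd p) = wt w" by auto
    show "aug_pow ys k (fst p) * aug ys (snd p) = 0"
    proof (cases "snd p = []")
      case False
      then have "wt (snd p) > 0" using wt_eq_0_iff[OF p(2)] by simp
      then show ?thesis using Suc.IH[OF p(1)] Suc.prems(2) p(3) by simp
    qed (simp add: aug_def)
  qed
qed simp

text \<open>A truncation bound independent of u is what allows the sum to be pulled out of a
  convolution.\<close>

lemma ev_inv_le:
  assumes "u \<in> valid_words" "wt u \<le> N"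
  shows "ev_inv ys u = (\<Sum>k\<le>N. aug_pow ys k u)"
  unfolding ev_inv_def by (rule sum.mono_neutral_left) (use assms aug_pow_eq_0 in auto)

text \<open>The powers are built by multiplication on the right; the left-handed recursion is needed
  for the right antipode identity.\<close>

lemma aug_conv_pow: "w \<in> valid_words \<Longrightarrow> conv (aug ys) (aug_pow ys k) w = aug_pow ys (Suc k) w"
proof (induction k arbitrary: w)
  case (Suc k)
  have "conv (aug ys) (aug_pow ys (Suc k)) w = conv (conv (aug ys) (aug_pow ys k)) (aug ys) w"
    using conv_assoc[OF Suc.prems] by simp
  also have "\<dots> = conv (aug_pow ys (Suc k)) (aug ys) w"
    by (rule conv_cong[OF Suc.prems]) (simp_all only: Suc.IH)
  finally show ?case by simp
qed (simp add: conv_unit_left conv_unit_right)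

text \<open>Writing \<open>ev ys\<close> as \<open>ev []\<close> minus \<open>aug ys\<close> makes
  the geometric series telescope to the power 0 minus the power \<open>Suc (wt w)\<close>, and the
  latter vanishes at w.\<close>

lemma ev_inv_conv: "w \<in> valid_words \<Longrightarrow> conv (ev_inv ys) (ev ys) w = ev [] w"
  and conv_ev_inv: "w \<in> valid_words \<Longrightarrow> conv (ev ys) (ev_inv ys) w = ev [] w"
proof -
  assume w: "w \<in> valid_words"
  let ?S = "\<lambda>u. \<Sum>k\<le>wt w. aug_pow ys k u"
  have "conv (ev_inv ys) (ev ys) w = conv ?S (\<lambda>v. ev [] v - aug ys v) w"
    by (rule conv_cong[OF w]) (use ev_inv_le in \<open>auto simp: aug_def\<close>)
  also have "\<dots> = (\<Sum>k\<le>wt w. aug_pow ys k w - aug_pow ys (Suc k) w)"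
    by (simp only: conv_diff_right conv_unit_right[OF w] conv_sum_left sum_subtractf aug_pow.simps(2))
  also have "\<dots> = ev [] w"
    using aug_pow_eq_0[OF w, of "Suc (wt w)"] by (subst sum_telescope) (simp del: aug_pow.simps(2))
  finally show "conv (ev_inv ys) (ev ys) w = ev [] w" .
  have "conv (ev ys) (ev_inv ys) w = conv (\<lambda>v. ev [] v - aug ys v) ?S w"
    by (rule conv_cong[OF w]) (use ev_inv_le in \<open>auto simp: aug_def\<close>)
  also have "\<dots> = (\<Sum>k\<le>wt w. aug_pow ys k w - aug_pow ys (Suc k) w)"
    by (simp only: conv_diff_left conv_unit_left[OF w] conv_sum_right aug_conv_pow[OF w] sum_subtractf)
  also have "\<dots> = ev [] w"
    using aug_pow_eq_0[OF w, of "Suc (wt w)"] by (subst sum_telescope) (simp del: aug_pow.simps(2))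
  finally show "conv (ev ys) (ev_inv ys) w = ev [] w" .
qed

text \<open>Being multiplicative, \<open>ev ys\<close> carries convolution powers of vector-valued
  maps to convolution powers of functionals.\<close>

lemma pair_antipode_pow: "w \<in> valid_words \<Longrightarrow> pair (antipode_pow k w) (ev ys) = aug_pow ys k w"
proof (induction k arbitrary: w)
  case (Suc k)
  have valid: "fst p \<in> valid_words" "snd p \<in> valid_words" if "cop w p \<noteq> 0" for p
    using fvecD[OF cop_in_fvec[OF Suc.prems] that] by auto
  have step: "pair (antipode_step v) (ev ys) = aug ys v" for v
    by (simp add: antipode_step_def aug_def pair_uminus)
  show ?case
    unfolding antipode_pow.simps aug_pow.simps conv_def
    apply (subst pair_lin[of _ _ valid_words])
     apply (intro shuffle_mult_fvec_valid antipode_pow_fvec antipode_step_fvec valid; assumption)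
    apply (rule pair_cong)
    apply (subst ev_shuffle_mult)
      apply (intro antipode_pow_fvec valid; assumption)
     apply (intro antipode_step_fvec valid; assumption)
    apply (simp add: step Suc.IH valid)
    done
qed simp

lemma pair_antipode: "w \<in> valid_words \<Longrightarrow> pair (antipode (delta w)) (ev ys) = ev_inv ys w"
  unfolding antipode_delta ev_inv_def
  by (subst pair_sum[of _ _ valid_words]) (simp_all add: antipode_pow_fvec pair_antipode_pow)

lemma pair_counit: "F \<in> fvec B \<Longrightarrow> pair F (ev []) = \<iota> (counit F)"
proof -
  assume "F \<in> fvec B"
  then have "finite (supp F)" by (rule fvec_finite)
  moreover have "pair F (ev []) = (\<Sum>b\<in>supp F. if b = [] then \<iota> (F []) else 0)"
    unfolding pair_def by (rule sum.cong) auto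
  ultimately show ?thesis by (auto simp: counit_def supp_def)
qed

end

lemma homog_fvec: "F \<in> fvec B \<Longrightarrow> homog wt n F \<Longrightarrow> F \<in> fvec {w \<in> B. wt w = n}"
  by (auto simp: fvec_def homog_def)

lemma fvec_homog: "F \<in> fvec {w \<in> B. wt w = n} \<Longrightarrow> homog wt n F"
  by (auto simp: fvec_def homog_def)

context flag_model
begin

section \<open>The Hopf algebra axioms\<close>

lemma pair_comb:
  assumes "F \<in> fvec B" "G \<in> fvec B"
  shows "pair (\<lambda>w. c * F w + G w) \<phi> = \<iota> c * pair F \<phi> + pair G \<phi>"
  using pair_add[OF fvec_scale[OF assms(1)] assms(2)] by (simp add: pair_scale)

lemma pair_antipode_vec:
  assumes "F \<in> fvec valid_words"
  shows "pair (antipode F) (ev ys) = pair F (ev_inv ys)"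
proof -
  have "pair (antipode F) (ev ys) = pair F (\<lambda>w. pair (antipode (delta w)) (ev ys))"
    unfolding antipode_lin[of F]
    by (rule pair_lin[of _ _ valid_words]) (use assms in \<open>auto dest: fvecD intro: antipode_delta_fvec\<close>)
  also have "\<dots> = pair F (ev_inv ys)"
    by (rule pair_fvec_cong[OF assms]) (rule pair_antipode)
  finally show ?thesis .
qed

context
  fixes F G H :: "'a word \<Rightarrow> 'a" and c :: 'a
  assumes F: "F \<in> fvec valid_words" and G: "G \<in> fvec valid_words" and H: "H \<in> fvec valid_words"
begin

lemma comb: "(\<lambda>w. c * F w + G w) \<in> fvec valid_words"
  by (intro fvec_add fvec_scale F G)

lemma shuffle_mult_linear:
  "shuffle_mult (\<lambda>w. c * F w + G w) H = (\<lambda>w. c * shuffle_mult F H w + shuffle_mult G H w)"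
  "shuffle_mult H (\<lambda>w. c * F w + G w) = (\<lambda>w. c * shuffle_mult H F w + shuffle_mult H G w)"
proof -
  note FH = shuffle_mult_fvec_valid[OF F H] and GH = shuffle_mult_fvec_valid[OF G H]
    and HF = shuffle_mult_fvec_valid[OF H F] and HG = shuffle_mult_fvec_valid[OF H G]
  show "shuffle_mult (\<lambda>w. c * F w + G w) H = (\<lambda>w. c * shuffle_mult F H w + shuffle_mult G H w)"
  proof (rule eq_by_ev)
    show "pair (shuffle_mult (\<lambda>w. c * F w + G w) H) (ev ys)
        = pair (\<lambda>w. c * shuffle_mult F H w + shuffle_mult G H w) (ev ys)" for ys
      by (simp add: ev_shuffle_mult comb F G H pair_comb[OF F G] pair_comb[OF FH GH] distrib_right mult.assoc)
  qed (intro shuffle_mult_fvec_valid comb H fvec_add fvec_scale F G)+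
  show "shuffle_mult H (\<lambda>w. c * F w + G w) = (\<lambda>w. c * shuffle_mult H F w + shuffle_mult H G w)"
  proof (rule eq_by_ev)
    show "pair (shuffle_mult H (\<lambda>w. c * F w + G w)) (ev ys)
        = pair (\<lambda>w. c * shuffle_mult H F w + shuffle_mult H G w) (ev ys)" for ys
      by (simp add: ev_shuffle_mult comb F G H pair_comb[OF F G] pair_comb[OF HF HG] distrib_left mult.left_commute)
  qed (intro shuffle_mult_fvec_valid comb H fvec_add fvec_scale F G)+
qed

lemma shuffle_mult_assoc: "shuffle_mult (shuffle_mult F G) H = shuffle_mult F (shuffle_mult G H)"
  by (rule eq_by_ev) (simp_all add: ev_shuffle_mult shuffle_mult_fvec_valid F G H mult.assoc)

lemma shuffle_mult_unit: "shuffle_mult (delta []) F = F" "shuffle_mult F (delta []) = F"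
  by (rule eq_by_ev; auto simp: ev_shuffle_mult F intro!: shuffle_mult_fvec_valid)+

lemma Cop_linear: "Cop (\<lambda>w. c * F w + G w) = (\<lambda>p. c * Cop F p + Cop G p)"
proof (rule eq_by_ev2)
  show "pair (Cop (\<lambda>w. c * F w + G w)) (\<lambda>p. ev zs (fst p) * ev ys (snd p))
      = pair (\<lambda>p. c * Cop F p + Cop G p) (\<lambda>p. ev zs (fst p) * ev ys (snd p))" for zs ys
    by (simp add: pair_Cop comb F G pair_comb[OF F G] pair_comb[OF Cop_fvec_valid[OF F] Cop_fvec_valid[OF G]])
qed (intro Cop_fvec_valid comb fvec_add fvec_scale F G)+

text \<open>The special case of the empty flag in \<open>ev_shuffle_mult\<close>.\<close>

lemma counit_mult: "counit (shuffle_mult F G) = counit F * counit G"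
  using ev_shuffle_mult[OF F G, of "[]"]
  unfolding pair_counit[OF F] pair_counit[OF G] pair_counit[OF shuffle_mult_fvec_valid[OF F G]]
  by (simp add: \<iota>_eq_iff flip: \<iota>_mult)

lemma ev_Cop: "pair (Cop F) (\<lambda>p. ev zs (fst p) * ev ys (snd p)) = pair F (ev (zs @ ys))"
  unfolding pair_Cop[OF F] by (rule pair_fvec_cong[OF F]) (rule ev_cop)

lemma antipode_linear: "antipode (\<lambda>w. c * F w + G w) = (\<lambda>w. c * antipode F w + antipode G w)"
proof (rule eq_by_ev)
  show "pair (antipode (\<lambda>w. c * F w + G w)) (ev ys)
      = pair (\<lambda>w. c * antipode F w + antipode G w) (ev ys)" for ys
    by (simp add: pair_antipode_vec comb F G pair_comb[OF F G] pair_comb[OF antipode_fvec[OF F] antipode_fvec[OF G]])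
qed (intro antipode_fvec comb fvec_add fvec_scale F G)+

lemma antipode_left:
  "lin (Cop F) (\<lambda>p. shuffle_mult (antipode (delta (fst p))) (delta (snd p))) = (\<lambda>w. counit F * delta [] w)"
  and antipode_right:
  "lin (Cop F) (\<lambda>p. shuffle_mult (delta (fst p)) (antipode (delta (snd p)))) = (\<lambda>w. counit F * delta [] w)"
proof -
  have valid: "(delta (fst p) :: _ \<Rightarrow> 'a) \<in> fvec valid_words" "(delta (snd p) :: _ \<Rightarrow> 'a) \<in> fvec valid_words"
    "antipode (delta (fst p)) \<in> fvec valid_words" "antipode (delta (snd p)) \<in> fvec valid_words"
    if "Cop F p \<noteq> 0" for p
    using Cop_support[OF F that] by (simp_all add: antipode_delta_fvec)
  have unit: "(\<lambda>w. counit F * delta [] w) \<in> fvec valid_words"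
    and ev_unit: "pair (\<lambda>w. counit F * delta [] w) (ev ys) = pair F (ev [])" for ys
    by (auto simp: pair_scale pair_counit[OF F])
  note terms = shuffle_mult_fvec_valid[OF valid(3) valid(2)] shuffle_mult_fvec_valid[OF valid(1) valid(4)]
  show "lin (Cop F) (\<lambda>p. shuffle_mult (antipode (delta (fst p))) (delta (snd p))) = (\<lambda>w. counit F * delta [] w)"
  proof (rule eq_by_ev[OF fvec_lin[OF terms(1)] unit], assumption+)
    fix ys
    have "pair (lin (Cop F) (\<lambda>p. shuffle_mult (antipode (delta (fst p))) (delta (snd p)))) (ev ys)
      = pair (Cop F) (\<lambda>p. pair (shuffle_mult (antipode (delta (fst p))) (delta (snd p))) (ev ys))"
      by (rule pair_lin[OF terms(1)])
    also have "\<dots> = pair (Cop F) (\<lambda>p. ev_inv ys (fst p) * ev ys (snd p))"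
      by (rule pair_cong) (use Cop_support[OF F] valid in \<open>simp add: ev_shuffle_mult pair_antipode\<close>)
    also have "\<dots> = pair F (conv (ev_inv ys) (ev ys))"
      by (simp add: pair_Cop[OF F] conv_def)
    also have "\<dots> = pair F (ev [])"
      by (rule pair_fvec_cong[OF F]) (rule ev_inv_conv)
    finally show "pair (lin (Cop F) (\<lambda>p. shuffle_mult (antipode (delta (fst p))) (delta (snd p)))) (ev ys)
        = pair (\<lambda>w. counit F * delta [] w) (ev ys)"
      by (simp only: ev_unit)
  qed
  show "lin (Cop F) (\<lambda>p. shuffle_mult (delta (fst p)) (antipode (delta (snd p)))) = (\<lambda>w. counit F * delta [] w)"
  proof (rule eq_by_ev[OF fvec_lin[OF terms(2)] unit], assumption+)
    fix ys
    have "pair (lin (Cop F) (\<lambda>p. shuffle_mult (delta (fst p)) (antipode (delta (snd p))))) (ev ys)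
      = pair (Cop F) (\<lambda>p. pair (shuffle_mult (delta (fst p)) (antipode (delta (snd p)))) (ev ys))"
      by (rule pair_lin[OF terms(2)])
    also have "\<dots> = pair (Cop F) (\<lambda>p. ev ys (fst p) * ev_inv ys (snd p))"
      by (rule pair_cong) (use Cop_support[OF F] valid in \<open>simp add: ev_shuffle_mult pair_antipode\<close>)
    also have "\<dots> = pair F (conv (ev ys) (ev_inv ys))"
      by (simp add: pair_Cop[OF F] conv_def)
    also have "\<dots> = pair F (ev [])"
      by (rule pair_fvec_cong[OF F]) (rule conv_ev_inv)
    finally show "pair (lin (Cop F) (\<lambda>p. shuffle_mult (delta (fst p)) (antipode (delta (snd p))))) (ev ys)
        = pair (\<lambda>w. counit F * delta [] w) (ev ys)"
      by (simp only: ev_unit)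
  qed
qed

end

text \<open>On a pair of flags the coproduct of a vector takes its value at \<open>zs @ ys\<close>,
  where evaluation is multiplicative; on the right-hand side the same product arises from
  multiplicativity on \<open>zs\<close> and \<open>ys\<close> separately.\<close>

lemma Cop_mult:
  fixes F G :: "'a word \<Rightarrow> 'a"
  assumes F: "F \<in> fvec valid_words" and G: "G \<in> fvec valid_words"
  shows "Cop (shuffle_mult F G) = lin (Cop F) (\<lambda>p. lin (Cop G) (\<lambda>p'.
    tensor (sh (fst p) (fst p')) (sh (snd p) (snd p'))))"
proof (rule eq_by_ev2)
  have FG: "shuffle_mult F G \<in> fvec valid_words" by (intro shuffle_mult_fvec_valid F G)
  have valid: "fst p \<in> valid_words" "snd p \<in> valid_words" "fst p' \<in> valid_words" "snd p' \<in> valid_words"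
    if "Cop F p \<noteq> 0" "Cop G p' \<noteq> 0" for p p'
    using Cop_support[OF F that(1)] Cop_support[OF G that(2)] by auto
  have summand: "tensor (sh (fst p) (fst p')) (sh (snd p) (snd p')) \<in> fvec (valid_words \<times> valid_words)"
    if "Cop F p \<noteq> 0" "Cop G p' \<noteq> 0" for p p'
    using valid[OF that] by (intro fvec_tensor sh_fvec_valid)
  show "Cop (shuffle_mult F G) \<in> fvec (valid_words \<times> valid_words)"
    by (intro Cop_fvec_valid FG)
  show "lin (Cop F) (\<lambda>p. lin (Cop G) (\<lambda>p'. tensor (sh (fst p) (fst p')) (sh (snd p) (snd p'))))
      \<in> fvec (valid_words \<times> valid_words)"
    by (intro fvec_lin summand)
  fix zs ys
  let ?\<phi> = "\<lambda>p. ev zs (fst p) * ev ys (snd p)"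
  have "pair (lin (Cop F) (\<lambda>p. lin (Cop G) (\<lambda>p'. tensor (sh (fst p) (fst p')) (sh (snd p) (snd p'))))) ?\<phi>
    = pair (Cop F) (\<lambda>p. pair (lin (Cop G) (\<lambda>p'. tensor (sh (fst p) (fst p')) (sh (snd p) (snd p')))) ?\<phi>)"
    by (rule pair_lin[of _ _ "valid_words \<times> valid_words"]) (intro fvec_lin summand)
  also have "\<dots> = pair (Cop F) (\<lambda>p. ?\<phi> p * pair (Cop G) ?\<phi>)"
  proof (rule pair_cong)
    fix p assume p: "Cop F p \<noteq> 0"
    have "pair (lin (Cop G) (\<lambda>p'. tensor (sh (fst p) (fst p')) (sh (snd p) (snd p')))) ?\<phi>
      = pair (Cop G) (\<lambda>p'. pair (tensor (sh (fst p) (fst p')) (sh (snd p) (snd p'))) ?\<phi>)"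
      by (rule pair_lin[OF summand[OF p]])
    also have "\<dots> = pair (Cop G) (\<lambda>p'. ?\<phi> p * ?\<phi> p')"
    proof (rule pair_cong)
      fix p' assume p': "Cop G p' \<noteq> 0"
      show "pair (tensor (sh (fst p) (fst p')) (sh (snd p) (snd p'))) ?\<phi> = ?\<phi> p * ?\<phi> p'"
        using valid[OF p p'] by (subst pair_tensor[of _ valid_words _ valid_words]) (auto simp: ev_sh)
    qed
    finally show "pair (lin (Cop G) (\<lambda>p'. tensor (sh (fst p) (fst p')) (sh (snd p) (snd p')))) ?\<phi>
      = ?\<phi> p * pair (Cop G) ?\<phi>"
      by (simp only: pair_const_mult)
  qed
  also have "\<dots> = pair (shuffle_mult F G) (ev (zs @ ys))"
    by (simp only: pair_mult_const ev_Cop[OF F F F] ev_Cop[OF G G G] ev_shuffle_mult[OF F G])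
  finally show "pair (Cop (shuffle_mult F G)) ?\<phi>
    = pair (lin (Cop F) (\<lambda>p. lin (Cop G) (\<lambda>p'. tensor (sh (fst p) (fst p')) (sh (snd p) (snd p'))))) ?\<phi>"
    by (simp only: ev_Cop[OF FG FG FG])
qed

lemma hopf_algebra:
  "hopf_algebra_on (valid_words :: 'a word set) shuffle_mult (delta []) Cop counit"
  unfolding hopf_algebra_on_def
proof (intro conjI ballI allI)
  fix F :: "'a word \<Rightarrow> 'a" assume F: "F \<in> fvec valid_words"
  show "(\<lambda>(x, y, z). \<Sum>p\<in>supp (Cop F). Cop F p * Cop (delta (fst p)) (x, y) * delta (snd p) z)
      = (\<lambda>(x, y, z). \<Sum>p\<in>supp (Cop F). Cop F p * delta (fst p) x * Cop (delta (snd p)) (y, z))"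
    using coassoc[OF F]
    by (simp add: cop_left_def cop_right_def lin_def[of "Cop F"] reassoc_def tensor_def Cop_lin[of "delta _"]
        fun_eq_iff mult.assoc)
  show "(\<lambda>w. \<Sum>p\<in>supp (Cop F). Cop F p * counit (delta (fst p)) * delta (snd p) w) = F"
    using counit_left[OF F] by (simp add: lin_def mult.assoc)
  show "(\<lambda>w. \<Sum>p\<in>supp (Cop F). Cop F p * delta (fst p) w * counit (delta (snd p))) = F"
    using counit_right[OF F] by (simp add: lin_def mult_ac)
next
  fix F G :: "'a word \<Rightarrow> 'a" assume F: "F \<in> fvec valid_words" and G: "G \<in> fvec valid_words"
  show "Cop (shuffle_mult F G) = (\<lambda>(x, y). \<Sum>p\<in>supp (Cop F). \<Sum>p'\<in>supp (Cop G).
            Cop F p * Cop G p' * shuffle_mult (delta (fst p)) (delta (fst p')) x *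
            shuffle_mult (delta (snd p)) (delta (snd p')) y)"
    unfolding Cop_mult[OF F G] by (simp add: lin_def tensor_def fun_eq_iff sum_distrib_left mult.assoc)
next
  show "Cop (delta []) = (\<lambda>(x, y). delta [] x * (delta [] y :: 'a))"
    by (subst Cop_lin, subst lin_delta) (auto simp: delta_def fun_eq_iff)
  show "\<exists>S. (\<forall>F\<in>fvec (valid_words :: 'a word set). (S F :: 'a word \<Rightarrow> 'a) \<in> fvec valid_words) \<and>
         (\<forall>F\<in>fvec valid_words. \<forall>G\<in>fvec valid_words. \<forall>c. S (\<lambda>w. c * F w + G w) = (\<lambda>w. c * S F w + S G w)) \<and>
         (\<forall>F\<in>fvec valid_words.
            (\<lambda>w. \<Sum>p\<in>supp (Cop F). Cop F p * shuffle_mult (S (delta (fst p))) (delta (snd p)) w) = (\<lambda>w. counit F * delta [] w) \<and>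
            (\<lambda>w. \<Sum>p\<in>supp (Cop F). Cop F p * shuffle_mult (delta (fst p)) (S (delta (snd p))) w) = (\<lambda>w. counit F * delta [] w))"
    by (intro exI[of _ antipode] conjI ballI allI)
       (simp_all only: antipode_fvec antipode_linear antipode_left[unfolded lin_def] antipode_right[unfolded lin_def])
qed (simp_all add: shuffle_mult_fvec_valid shuffle_mult_linear shuffle_mult_assoc shuffle_mult_unit
    Cop_fvec_valid Cop_linear counit_mult, simp_all add: counit_def delta_def)

lemma connected_graded_hopf:
  "connected_graded_hopf_finite_type (valid_words :: 'a word set) shuffle_mult (delta []) Cop counit wt"
  unfolding connected_graded_hopf_finite_type_def
proof (intro conjI ballI allI impI)
  show "homog wt 0 (delta [] :: 'a word \<Rightarrow> 'a)" by (simp add: homog_def)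
next
  fix F G :: "'a word \<Rightarrow> 'a" and i j
  assume "F \<in> fvec valid_words" "G \<in> fvec valid_words" "homog wt i F \<and> homog wt j G"
  then show "homog wt (i + j) (shuffle_mult F G)"
    by (blast intro: fvec_homog[OF shuffle_mult_in_fvec[OF homog_fvec homog_fvec]])
next
  fix F :: "'a word \<Rightarrow> 'a" and n p
  assume F: "F \<in> fvec valid_words" "homog wt n F" and "p \<in> supp (Cop F)"
  then have "lin F cop p \<noteq> 0" by (simp add: supp_def Cop_lin)
  then obtain w where w: "F w \<noteq> 0" "cop w p \<noteq> 0" by (rule lin_nonzeroE)
  then have "w \<in> valid_words" "wt w = n" using fvecD[OF homog_fvec[OF F] w(1)] by auto
  with fvecD[OF cop_in_fvec w(2)] show "wt (fst p) + wt (snd p) = n" by simp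
next
  fix F :: "'a word \<Rightarrow> 'a" and n
  assume "n > 0 \<and> homog wt n F"
  then show "counit F = 0" by (auto simp: counit_def homog_def supp_def)
next
  fix F :: "'a word \<Rightarrow> 'a"
  assume F: "F \<in> fvec valid_words" "homog wt 0 F"
  have "F w = 0" if "w \<noteq> []" for w
  proof (rule ccontr)
    assume "F w \<noteq> 0"
    from fvecD[OF homog_fvec[OF F] this] show False using wt_eq_0_iff[of w] that by simp
  qed
  then have "F = (\<lambda>w. F [] * delta [] w)" by (auto simp: delta_def)
  then show "\<exists>c. F = (\<lambda>w. c * delta [] w)" by blast
qed (rule hopf_algebra finite_valid_words_wt)+

end

theorem theorem6p9:
  "connected_graded_hopf_finite_type (valid_words :: 'a::{field,finite} word set)
     shuffle_mult (delta []) Cop counit wt"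
proof -
  \<comment> \<open>The large field is the field of rational functions over F_q, with F_q embedded
    as constants; the powers of the indeterminate show that it is infinite.\<close>
  interpret flag_model "\<lambda>c :: 'a. to_fract [:c:]" "CARD('a)"
  proof
    show "to_fract [:x + y:] = to_fract [:x:] + to_fract [:y:]" for x y :: 'a
      by (simp flip: to_fract_add)
    show "to_fract [:x * y:] = to_fract [:x:] * to_fract [:y:]" for x y :: 'a
      by (simp flip: to_fract_mult)
    show "to_fract [:1 :: 'a:] = 1"
      by (simp flip: one_pCons)
    have "inj (\<lambda>n. to_fract (monom (1 :: 'a) n))"
      by (rule injI) (use degree_monom_eq[of "1 :: 'a"] in \<open>metis to_fract_eq_iff zero_neq_one\<close>)
    then have "infinite (range (\<lambda>n. to_fract (monom (1 :: 'a) n)))"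
      by (rule range_inj_infinite)
    then show "infinite (UNIV :: 'a poly fract set)"
      by (rule infinite_super[rotated]) simp
  qed simp
  show ?thesis by (rule connected_graded_hopf)
qed

end
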